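(* Let $q>1$, let $\mathfrak{G}$ be a finite $(q+1)$-regular graph, and fix $\vartheta\in(0,1)$. For $\omega\in C^{\mathrm{lc}}(\mathfrak{P}^\pm)$ consider the weighted transfer operator $\mathcal{L}_{\pm,\omega}$ on $\mathcal{F}_\vartheta(\mathfrak{P}^\pm)$. - If $\omega\ne0$, then the resolvent $\mathbf{R}_\omega(s)=(\mathrm{Id}-q^{\frac12+is}\mathcal{L}_{\pm,\omega})^{-1}:\mathcal{F}_\vartheta(\mathfrak{P}^\pm)\to\mathcal{F}_\vartheta(\mathfrak{P}^\pm)$ admits a meromorphic continuation, as a family of bounded operators on $\mathcal{F}_\vartheta(\mathfrak{P}^\pm)$, to the half-plane $$\mathscr{H}_{\vartheta,\omega}=\Big\{s\in\mathbb{C}\;\Big|\;\mathrm{Im}(s)>\frac32+\frac{\log(\vartheta\|\omega\|_\infty)}{\log q}\Big\},$$ and its poles have finite-rank principal parts. - If $\omega=0$, then $\mathcal{L}_{\pm,\omega}=0$ and $\mathbf{R}_\omega(s)=\mathrm{Id}$ for every $s\in\mathbb{C}$.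
   Context: $\mathfrak{G}=(\mathfrak{X},\mathfrak{E})$ is a finite connected simple $(q+1)$-regular graph with directed edge set $\mathfrak{E}\subset\mathfrak{X}^2$ closed under reversal; $\iota(\vec e),\tau(\vec e)$ are the initial and terminal vertices and $\vec e^{\,\mathrm{op}}$ the reversed edge. A sequence of edges is admissible if consecutive edges $\vec a,\vec b$ satisfy $\tau(\vec a)=\iota(\vec b)$ and $\vec b\ne\vec a^{\,\mathrm{op}}$. $\mathfrak{P}^+$ is the set of admissible right-infinite sequences $(\vec e_1,\vec e_2,\ldots)$ and $\mathfrak{P}^-$ the set of admissible left-infinite sequences $(\ldots,\vec e_2,\vec e_1)$; $\sigma_\pm$ drops $\vec e_1$. For $\vartheta\in(0,1)$, $d_\vartheta(\mathbf{p},\mathbf{p}')=\vartheta^{\kappa}$ where $\kappa$ is the smallest $i\ge1$ for which the $i$-th edges (counted from $\vec e_1$) differ, and $d_\vartheta(\mathbf p,\mathbf p)=0$. $\mathcal{F}_\vartheta(\mathfrak{P}^\pm)$ is the Banach space of $d_\vartheta$-Lipschitz functions $\mathfrak{P}^\pm\to\mathbb{C}$ with norm $\|f\|_\vartheta=|f|_\vartheta+\|f\|_\infty$, $|f|_\vartheta$ the best Lipschitz constant. $C^{\mathrm{lc}}(\mathfrak{P}^\pm)$ is the space of locally constant functions (depending only on finitely many initial edges). For $\omega\in C^{\mathrm{lc}}(\mathfrak{P}^\pm)$, $$(\mathcal{L}_{\pm,\omega}\varphi)(\mathbf{p})=\sum_{\sigma_\pm(\mathbf{p}')=\mathbf{p}}\omega(\mathbf{p}')\varphi(\mathbf{p}').$$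 The inverse defining $\mathbf{R}_\omega(s)$ exists as a Neumann series for $\mathrm{Im}(s)$ sufficiently large. *)

theory Defs
  imports "HOL-Analysis.Analysis" "Graph_Theory.Graph_Theory"
begin

text \<open>
  Index \<open>i\<close> of a sequence holds the edge usually numbered \<open>i + 1\<close>, for both directions: a
  left-infinite sequence \<open>(\<dots>, e\<^sub>2, e\<^sub>1)\<close> is stored as \<open>0 \<mapsto> e\<^sub>1, 1 \<mapsto> e\<^sub>2, \<dots>\<close>.  Hence the two
  path spaces differ only in the orientation of the admissibility condition.
\<close>

type_synonym 'v edge_seq = "nat \<Rightarrow> 'v \<times> 'v"

definition admissible :: "'v \<times> 'v \<Rightarrow> 'v \<times> 'v \<Rightarrow> bool" where
  "admissible a b \<longleftrightarrow> snd a = fst b \<and> b \<noteq> prod.swap a"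

definition right_paths :: "'v pair_pre_digraph \<Rightarrow> 'v edge_seq set" where
  "right_paths G = {p. \<forall>i. p i \<in> parcs G \<and> admissible (p i) (p (Suc i))}"

definition left_paths :: "'v pair_pre_digraph \<Rightarrow> 'v edge_seq set" where
  "left_paths G = {p. \<forall>i. p i \<in> parcs G \<and> admissible (p (Suc i)) (p i)}"

definition shift :: "'v edge_seq \<Rightarrow> 'v edge_seq" where
  "shift p = (\<lambda>i. p (Suc i))"

definition path_dist :: "real \<Rightarrow> 'v edge_seq \<Rightarrow> 'v edge_seq \<Rightarrow> real" where
  "path_dist \<theta> p p' = (if p = p' then 0 else \<theta> ^ Suc (LEAST i. p i \<noteq> p' i))"

text \<open>
  A complex function on a path space \<open>P\<close> is represented by its extension by zero to all edge
  sequences.  Equality of such functions is then equality in HOL.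
\<close>

definition lip_on :: "real \<Rightarrow> 'v edge_seq set \<Rightarrow> real \<Rightarrow> ('v edge_seq \<Rightarrow> complex) \<Rightarrow> bool" where
  "lip_on \<theta> P C f \<longleftrightarrow>
     0 \<le> C \<and> (\<forall>p\<in>P. \<forall>p'\<in>P. cmod (f p - f p') \<le> C * path_dist \<theta> p p')"

definition lip_space :: "real \<Rightarrow> 'v edge_seq set \<Rightarrow> ('v edge_seq \<Rightarrow> complex) set" where
  "lip_space \<theta> P = {f. (\<forall>p. p \<notin> P \<longrightarrow> f p = 0) \<and> (\<exists>C. lip_on \<theta> P C f)}"

definition lip_seminorm :: "real \<Rightarrow> 'v edge_seq set \<Rightarrow> ('v edge_seq \<Rightarrow> complex) \<Rightarrow> real" where
  "lip_seminorm \<theta> P f = Inf {C. lip_on \<theta> P C f}"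

definition sup_norm :: "'v edge_seq set \<Rightarrow> ('v edge_seq \<Rightarrow> complex) \<Rightarrow> real" where
  "sup_norm P f = (SUP p\<in>P. cmod (f p))"

definition lip_norm :: "real \<Rightarrow> 'v edge_seq set \<Rightarrow> ('v edge_seq \<Rightarrow> complex) \<Rightarrow> real" where
  "lip_norm \<theta> P f = lip_seminorm \<theta> P f + sup_norm P f"

definition locally_constant :: "'v edge_seq set \<Rightarrow> ('v edge_seq \<Rightarrow> complex) set" where
  "locally_constant P = {f. (\<forall>p. p \<notin> P \<longrightarrow> f p = 0) \<and>
     (\<exists>n. \<forall>p\<in>P. \<forall>p'\<in>P. (\<forall>i<n. p i = p' i) \<longrightarrow> f p = f p')}"

type_synonym 'v operator = "('v edge_seq \<Rightarrow> complex) \<Rightarrow> 'v edge_seq \<Rightarrow> complex"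

definition transfer_op :: "'v edge_seq set \<Rightarrow> ('v edge_seq \<Rightarrow> complex) \<Rightarrow> 'v operator" where
  "transfer_op P \<omega> \<phi> = (\<lambda>p. \<Sum>p' | p' \<in> P \<and> shift p' = p. \<omega> p' * \<phi> p')"

text \<open>
  Operators on \<open>lip_space \<theta> P\<close> are HOL functions of which only the values on that space matter;
  all notions below are insensitive to the values elsewhere.
\<close>

definition bounded_op :: "real \<Rightarrow> 'v edge_seq set \<Rightarrow> 'v operator \<Rightarrow> bool" where
  "bounded_op \<theta> P T \<longleftrightarrow>
     (\<forall>\<phi>\<in>lip_space \<theta> P. T \<phi> \<in> lip_space \<theta> P) \<and>
     (\<forall>\<phi>\<in>lip_space \<theta> P. \<forall>\<psi>\<in>lip_space \<theta> P. \<forall>a b.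
        T (\<lambda>p. a * \<phi> p + b * \<psi> p) = (\<lambda>p. a * T \<phi> p + b * T \<psi> p)) \<and>
     (\<exists>C. \<forall>\<phi>\<in>lip_space \<theta> P. lip_norm \<theta> P (T \<phi>) \<le> C * lip_norm \<theta> P \<phi>)"

definition op_norm :: "real \<Rightarrow> 'v edge_seq set \<Rightarrow> 'v operator \<Rightarrow> real" where
  "op_norm \<theta> P T = (SUP \<phi>\<in>lip_space \<theta> P. lip_norm \<theta> P (T \<phi>) / lip_norm \<theta> P \<phi>)"

definition inverse_ops :: "real \<Rightarrow> 'v edge_seq set \<Rightarrow> 'v operator \<Rightarrow> 'v operator \<Rightarrow> bool" where
  "inverse_ops \<theta> P T S \<longleftrightarrow> bounded_op \<theta> P T \<and> bounded_op \<theta> P S \<and>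
     (\<forall>\<phi>\<in>lip_space \<theta> P. T (S \<phi>) = \<phi> \<and> S (T \<phi>) = \<phi>)"

definition finite_rank :: "real \<Rightarrow> 'v edge_seq set \<Rightarrow> 'v operator \<Rightarrow> bool" where
  "finite_rank \<theta> P T \<longleftrightarrow> (\<exists>B. finite B \<and> B \<subseteq> lip_space \<theta> P \<and>
     (\<forall>\<phi>\<in>lip_space \<theta> P. \<exists>c. T \<phi> = (\<lambda>p. \<Sum>b\<in>B. c b * b p)))"

text \<open>Complex differentiability with respect to the operator norm.\<close>

definition op_holomorphic_on ::
    "real \<Rightarrow> 'v edge_seq set \<Rightarrow> (complex \<Rightarrow> 'v operator) \<Rightarrow> complex set \<Rightarrow> bool" where
  "op_holomorphic_on \<theta> P M U \<longleftrightarrow>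
     (\<forall>s\<in>U. bounded_op \<theta> P (M s)) \<and>
     (\<forall>s\<in>U. \<exists>D. bounded_op \<theta> P D \<and>
        ((\<lambda>w. op_norm \<theta> P (\<lambda>\<phi> p. (M w \<phi> p - M s \<phi> p) / (w - s) - D \<phi> p)) \<longlongrightarrow> 0)
          (at s within U))"

text \<open>
  \<open>M\<close> has a pole of order \<open>N \<ge> 1\<close> at \<open>s\<^sub>0\<close> with principal part
  \<open>\<Sum>j=1..N. A j / (s - s\<^sub>0) ^ j\<close>.
\<close>

definition has_principal_part ::
    "real \<Rightarrow> 'v edge_seq set \<Rightarrow> (complex \<Rightarrow> 'v operator) \<Rightarrow> complex \<Rightarrow>
     nat \<Rightarrow> (nat \<Rightarrow> 'v operator) \<Rightarrow> bool" where
  "has_principal_part \<theta> P M s0 N A \<longleftrightarrow>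
     1 \<le> N \<and> (\<forall>j\<in>{1..N}. bounded_op \<theta> P (A j)) \<and>
     (\<exists>\<phi>\<in>lip_space \<theta> P. A N \<phi> \<noteq> (\<lambda>_. 0)) \<and>
     (\<exists>r>0. \<exists>H. op_holomorphic_on \<theta> P H (ball s0 r) \<and>
        (\<forall>s\<in>ball s0 r - {s0}. \<forall>\<phi>\<in>lip_space \<theta> P.
           M s \<phi> = (\<lambda>p. (\<Sum>j=1..N. A j \<phi> p / (s - s0) ^ j) + H s \<phi> p)))"

text \<open>The value of \<open>M\<close> at a point of \<open>S\<close>, the set of its poles, is irrelevant.\<close>

definition op_meromorphic_on ::
    "real \<Rightarrow> 'v edge_seq set \<Rightarrow> (complex \<Rightarrow> 'v operator) \<Rightarrow> complex set \<Rightarrow> complex set \<Rightarrow> bool"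
  where
  "op_meromorphic_on \<theta> P M U S \<longleftrightarrow>
     S \<subseteq> U \<and> S sparse_in U \<and> op_holomorphic_on \<theta> P M (U - S) \<and>
     (\<forall>s0\<in>S. \<exists>N A. has_principal_part \<theta> P M s0 N A)"

definition is_resolvent ::
    "nat \<Rightarrow> real \<Rightarrow> 'v edge_seq set \<Rightarrow> ('v edge_seq \<Rightarrow> complex) \<Rightarrow> complex \<Rightarrow> 'v operator \<Rightarrow> bool"
  where
  "is_resolvent q \<theta> P \<omega> s R \<longleftrightarrow>
     inverse_ops \<theta> P
       (\<lambda>\<phi> p. \<phi> p - of_nat q powr (1 / 2 + \<i> * s) * transfer_op P \<omega> \<phi> p) R"

definition half_plane ::
    "nat \<Rightarrow> real \<Rightarrow> 'v edge_seq set \<Rightarrow> ('v edge_seq \<Rightarrow> complex) \<Rightarrow> complex set" where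
  "half_plane q \<theta> P \<omega> = {s. Im s > 3 / 2 + ln (\<theta> * sup_norm P \<omega>) / ln (real q)}"

end

theory Submission
  imports Defs "HOL-Complex_Analysis.Complex_Analysis"
begin

text \<open>
  Write \<open>z = q powr (1/2 + \<i> s)\<close>.  The weight depends on the first \<open>n \<ge> 1\<close> edges only, so the transfer
  operator \<open>L\<close> preserves the finite-dimensional space \<open>V\<close> of functions of the first \<open>n\<close> edges.
  Two paths in one cylinder of length \<open>n\<close> have preimages with equal weights, closer to
  each other by the factor \<open>\<theta>\<close>; hence on the quotient by \<open>V\<close> the powers \<open>L\<^sup>k\<close> have norm
  \<open>O((q \<theta> \<parallel>\<omega>\<parallel>)\<^sup>k)\<close> and the Neumann series there converges for \<open>|z| q \<theta> \<parallel>\<omega>\<parallel> < 1\<close>, which is the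
  half-plane of the theorem.  On \<open>V\<close> the resolvent is a rational function of \<open>z\<close>.  Since \<open>1 - z L\<close>
  is block triangular, the two pieces combine to the resolvent on the whole space, and all
  singular parts take values in \<open>V\<close>.
\<close>

section \<open>Cauchy estimates\<close>

text \<open>An explicit formula for the resolvent takes the place of a Fredholm argument. The series
  \<open>neumann\<close> solves \<open>(1 - z L) f = \<phi>\<close> modulo cylinder functions; what
  it leaves unsolved is a cylinder function, which a polynomial in \<open>L\<close> divided by the
  scalar \<open>rev_poly\<close> corrects. Singularities can thus come only from the zeros of one
  entire function of \<open>s\<close>. Two points shape the rest. Bounds have to hold in the
  Lipschitz norm, yet all limits are taken pointwise; so operators are estimated through values and
  differences of values, to which scalar theorems on power series and holomorphic functions apply.
  And a zero of the denominator need not be a pole: \<open>has_principal_part\<close> demands a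
  nonzero top coefficient, so zeros where the quotient stays holomorphic must be recognised and
  filled in. The family is a right inverse throughout the half-plane, away from the zeros; that it
  is also a left inverse is checked for large \<open>Im s\<close>, where the supremum norm makes
  \<open>1 - z L\<close> injective, and this is all that a continuation has to match.\<close>

lemma deriv_bound_ball:
  fixes f :: "complex \<Rightarrow> complex"
  assumes "f holomorphic_on ball s r" "0 < r" "\<And>w. w \<in> ball s r \<Longrightarrow> cmod (f w) \<le> B"
  shows "cmod (deriv f s) \<le> 2 * B / r"
proof -
  \<comment> \<open>Cauchy's inequality asks for continuity up to the boundary circle; half the
    radius provides it at the cost of the factor 2.\<close>
  have "cball s (r/2) \<subseteq> ball s r" using assms(2) by auto
  then have "continuous_on (cball s (r/2)) f" "f holomorphic_on ball s (r/2)"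
    using assms(1) holomorphic_on_imp_continuous_on holomorphic_on_subset continuous_on_subset
    by (blast, meson ball_subset_cball holomorphic_on_subset subset_trans)
  moreover have "cmod (f x) \<le> B" if "norm (s - x) = r/2" for x
    using that assms(2) by (intro assms(3)) (auto simp: dist_norm)
  ultimately have "cmod ((deriv ^^ 1) f s) \<le> fact 1 * B / (r/2)^1"
    using assms(2) by (intro Cauchy_inequality) auto
  then show ?thesis by (simp add: field_simps)
qed

text \<open>Each point of the half-size ball has a ball of radius \<open>r/2\<close> inside the
  domain, so one bound \<open>4 * B / r\<close> on the derivative holds along every segment to the
  centre.\<close>

lemma holomorphic_lipschitz_at_center:
  fixes f :: "complex \<Rightarrow> complex"
  assumes hol: "f holomorphic_on ball s r" and "0 < r"
    and B: "\<And>w. w \<in> ball s r \<Longrightarrow> cmod (f w) \<le> B" and w: "w \<in> ball s (r/2)"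
  shows "cmod (f w - f s) \<le> 4 * B / r * cmod (w - s)"
proof (rule field_differentiable_bound[where S = "ball s (r/2)" and f' = "deriv f"])
  fix x assume x: "x \<in> ball s (r/2)"
  have sub: "ball x (r/2) \<subseteq> ball s r"
  proof
    fix y assume "y \<in> ball x (r/2)"
    then show "y \<in> ball s r" using x dist_triangle[of s y x] by simp
  qed
  have "cmod (deriv f x) \<le> 2 * B / (r/2)"
    using sub \<open>0 < r\<close> hol B by (intro deriv_bound_ball) (auto intro: holomorphic_on_subset)
  then show "cmod (deriv f x) \<le> 4 * B / r" by (simp add: field_simps)
  have "x \<in> ball s r" using x \<open>0 < r\<close> by auto
  then have "(f has_field_derivative deriv f x) (at x)"
    using hol holomorphic_derivI by blast
  then show "(f has_field_derivative deriv f x) (at x within ball s (r/2))"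
    using has_field_derivative_at_within by blast
qed (use w \<open>0 < r\<close> in auto)

section \<open>Operators on the space of Lipschitz functions\<close>

lemma path_dist_nonneg: "0 \<le> \<theta> \<Longrightarrow> 0 \<le> path_dist \<theta> p p'"
  by (simp add: path_dist_def)

lemma path_dist_le:
  assumes "0 < \<theta>" "\<theta> < 1" "\<And>i. i < m \<Longrightarrow> p i = p' i"
  shows "path_dist \<theta> p p' \<le> \<theta> ^ Suc m"
proof (cases "p = p'")
  case False
  then have "\<exists>i. p i \<noteq> p' i" by auto
  then have "p (LEAST i. p i \<noteq> p' i) \<noteq> p' (LEAST i. p i \<noteq> p' i)" by (rule LeastI_ex)
  then have "m \<le> (LEAST i. p i \<noteq> p' i)" using assms(3) not_le by blast
  then show ?thesis using False assms(1,2) by (simp add: path_dist_def mult_left_mono power_decreasing)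
qed (use assms in \<open>simp add: path_dist_def\<close>)

lemma path_dist_ge:
  assumes "0 < \<theta>" "\<theta> < 1" "i < m" "p i \<noteq> p' i"
  shows "\<theta> ^ m \<le> path_dist \<theta> p p'"
proof -
  have "(LEAST i. p i \<noteq> p' i) \<le> i" using assms(4) by (rule Least_le)
  then have "Suc (LEAST i. p i \<noteq> p' i) \<le> m" using assms(3) by simp
  then show ?thesis using assms power_decreasing[of "Suc (LEAST i. p i \<noteq> p' i)" m \<theta>]
    by (auto simp: path_dist_def)
qed

lemma path_dist_case_nat:
  "path_dist \<theta> (case_nat e p) (case_nat e p') = \<theta> * path_dist \<theta> p p'"
proof (cases "p = p'")
  case False
  then have ne: "case_nat e p \<noteq> case_nat e p'"
    by (metis (no_types) ext old.nat.simps(5))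
  obtain i where i: "p i \<noteq> p' i" using False by auto
  have "(LEAST i. case_nat e p i \<noteq> case_nat e p' i) = Suc (LEAST i. p i \<noteq> p' i)"
    using Least_Suc[of "\<lambda>i. case_nat e p i \<noteq> case_nat e p' i" "Suc i"] i by simp
  then show ?thesis using False ne by (simp add: path_dist_def)
qed (simp add: path_dist_def)

locale lipschitz_functions =
  fixes \<theta> :: real and P :: "'v edge_seq set"
  assumes theta: "0 < \<theta>" "\<theta> < 1" and nonempty: "P \<noteq> {}"
begin

abbreviation F where "F \<equiv> lip_space \<theta> P"
abbreviation nrm where "nrm \<equiv> lip_norm \<theta> P"

text \<open>A single constant for supremum and Lipschitz bound replaces the \<open>Inf\<close> and
  \<open>SUP\<close> of \<open>lip_norm\<close> in all estimates; the two agree up to the factor 2,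
  by \<open>bnd_nrm\<close> and \<open>nrm_le\<close>.\<close>

definition bnd :: "real \<Rightarrow> ('v edge_seq \<Rightarrow> complex) \<Rightarrow> bool" where
  "bnd K f \<longleftrightarrow> (\<forall>p. p \<notin> P \<longrightarrow> f p = 0) \<and> (\<forall>p\<in>P. cmod (f p) \<le> K) \<and> lip_on \<theta> P K f"

lemma dist_nonneg [simp]: "0 \<le> path_dist \<theta> p p'"
  using theta by (simp add: path_dist_nonneg)

lemma dist_le1: "path_dist \<theta> p p' \<le> 1"
  using path_dist_le[of \<theta> 0 p p'] theta by simp

lemma bnd_nonneg: "bnd K f \<Longrightarrow> 0 \<le> K"
  by (simp add: bnd_def lip_on_def)

lemma bnd_sup: "bnd K f \<Longrightarrow> cmod (f p) \<le> K"
  using bnd_nonneg[of K f] by (cases "p \<in> P") (auto simp: bnd_def)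

lemma bnd_lip: "bnd K f \<Longrightarrow> p \<in> P \<Longrightarrow> p' \<in> P \<Longrightarrow> cmod (f p - f p') \<le> K * path_dist \<theta> p p'"
  by (simp add: bnd_def lip_on_def)

lemma bnd_zero: "bnd K f \<Longrightarrow> p \<notin> P \<Longrightarrow> f p = 0"
  by (simp add: bnd_def)

lemma bndI:
  assumes "\<And>p. p \<notin> P \<Longrightarrow> f p = 0" "\<And>p. p \<in> P \<Longrightarrow> cmod (f p) \<le> K"
    "\<And>p p'. p \<in> P \<Longrightarrow> p' \<in> P \<Longrightarrow> cmod (f p - f p') \<le> K * path_dist \<theta> p p'"
  shows "bnd K f"
proof -
  obtain p where "p \<in> P" using nonempty by auto
  then have "0 \<le> K" using assms(2) norm_ge_zero order_trans by blast
  then show ?thesis using assms by (simp add: bnd_def lip_on_def)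
qed

lemma bnd_mono:
  assumes "bnd K f" "K \<le> K'" shows "bnd K' f"
proof (rule bndI)
  show "cmod (f p) \<le> K'" for p using bnd_sup[OF assms(1), of p] assms(2) by simp
  show "cmod (f p - f p') \<le> K' * path_dist \<theta> p p'" if "p \<in> P" "p' \<in> P" for p p'
    using bnd_lip[OF assms(1) that] mult_right_mono[OF assms(2) dist_nonneg[of p p']] by linarith
qed (use assms in \<open>simp add: bnd_zero\<close>)

lemma bnd_0 [simp]: "0 \<le> K \<Longrightarrow> bnd K (\<lambda>_. 0)"
  by (intro bndI) auto

lemma bnd_add:
  assumes "bnd K f" "bnd K' g" shows "bnd (K + K') (\<lambda>p. f p + g p)"
proof (rule bndI)
  show "cmod (f p + g p) \<le> K + K'" for p
    using bnd_sup[OF assms(1), of p] bnd_sup[OF assms(2), of p] norm_triangle_ineq[of "f p" "g p"] by simp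
  fix p p' assume "p \<in> P" "p' \<in> P"
  then have "cmod (f p - f p') + cmod (g p - g p') \<le> (K + K') * path_dist \<theta> p p'"
    using bnd_lip[OF assms(1), of p p'] bnd_lip[OF assms(2), of p p'] by (simp add: distrib_right)
  then show "cmod (f p + g p - (f p' + g p')) \<le> (K + K') * path_dist \<theta> p p'"
    using norm_triangle_ineq[of "f p - f p'" "g p - g p'"] by (simp add: algebra_simps)
qed (use assms in \<open>simp add: bnd_zero\<close>)

lemma bnd_scale:
  assumes "bnd K f" shows "bnd (cmod c * K) (\<lambda>p. c * f p)"
proof (rule bndI)
  show "cmod (c * f p) \<le> cmod c * K" for p
    using bnd_sup[OF assms, of p] by (simp add: norm_mult mult_left_mono)
  fix p p' assume "p \<in> P" "p' \<in> P"
  then show "cmod (c * f p - c * f p') \<le> cmod c * K * path_dist \<theta> p p'"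
    using bnd_lip[OF assms, of p p']
    by (simp add: norm_mult mult_left_mono mult.assoc flip: right_diff_distrib)
qed (use assms in \<open>simp add: bnd_zero\<close>)

text \<open>The path space has diameter at most 1, so a Lipschitz function deviates from its value
  at a base point by at most its Lipschitz constant.\<close>

lemma lip_space_iff_bnd: "f \<in> F \<longleftrightarrow> (\<exists>K. bnd K f)"
proof
  assume "f \<in> F"
  then obtain C where f0: "\<And>p. p \<notin> P \<Longrightarrow> f p = 0" and C: "lip_on \<theta> P C f"
    by (auto simp: lip_space_def)
  obtain p0 where p0: "p0 \<in> P" using nonempty by auto
  have "bnd (C + cmod (f p0)) f"
  proof (rule bndI)
    have C0: "0 \<le> C" using C by (simp add: lip_on_def)
    show "cmod (f p) \<le> C + cmod (f p0)" if "p \<in> P" for p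
    proof -
      have "cmod (f p - f p0) \<le> C * path_dist \<theta> p p0" using C that p0 by (simp add: lip_on_def)
      also have "\<dots> \<le> C" using C0 dist_le1[of p p0] mult_left_le by blast
      finally show ?thesis using norm_triangle_sub[of "f p" "f p0"] by simp
    qed
    show "cmod (f p - f p') \<le> (C + cmod (f p0)) * path_dist \<theta> p p'" if "p \<in> P" "p' \<in> P" for p p'
    proof -
      have "cmod (f p - f p') \<le> C * path_dist \<theta> p p'" using C that by (simp add: lip_on_def)
      moreover have "0 \<le> cmod (f p0) * path_dist \<theta> p p'" by simp
      ultimately show ?thesis unfolding distrib_right by linarith
    qed
  qed (fact f0)
  then show "\<exists>K. bnd K f" by blast
qed (auto simp: lip_space_def bnd_def)

text \<open>The infimum of the Lipschitz constants is itself one, since every difference quotient is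
  a lower bound of the set.\<close>

lemma bnd_nrm:
  assumes "f \<in> F" shows "bnd (nrm f) f"
proof -
  obtain K where K: "bnd K f" using assms lip_space_iff_bnd by blast
  let ?S = "{C. lip_on \<theta> P C f}"
  have S: "K \<in> ?S" using K by (simp add: bnd_def)
  have bd: "bdd_below ?S" by (rule bdd_belowI[of _ 0]) (simp add: lip_on_def)
  have L0: "0 \<le> lip_seminorm \<theta> P f"
    unfolding lip_seminorm_def using S by (intro cInf_greatest) (auto simp: lip_on_def)
  have lip: "cmod (f p - f p') \<le> lip_seminorm \<theta> P f * path_dist \<theta> p p'" if "p \<in> P" "p' \<in> P" for p p'
  proof (cases "path_dist \<theta> p p' = 0")
    case True
    then have "cmod (f p - f p') \<le> 0" using bnd_lip[OF K that] by simp
    then show ?thesis using True by simp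
  next
    case False
    then have d: "0 < path_dist \<theta> p p'" using dist_nonneg[of p p'] by linarith
    have "cmod (f p - f p') / path_dist \<theta> p p' \<le> lip_seminorm \<theta> P f"
      unfolding lip_seminorm_def using S d that
      by (intro cInf_greatest) (auto simp: lip_on_def field_simps)
    then show ?thesis using d by (simp add: field_simps)
  qed
  have "bdd_above ((\<lambda>p. cmod (f p)) ` P)" using bnd_sup[OF K] by (intro bdd_aboveI[of _ K]) auto
  then have sup: "cmod (f p) \<le> sup_norm P f" if "p \<in> P" for p
    unfolding sup_norm_def using that by (rule cSUP_upper2) auto
  have sup0: "0 \<le> sup_norm P f" using sup nonempty norm_ge_zero order_trans by blast
  show ?thesis
  proof (rule bndI)
    fix p p' assume "p \<in> P" "p' \<in> P"
    then show "cmod (f p - f p') \<le> nrm f * path_dist \<theta> p p'"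
      using lip[of p p'] mult_nonneg_nonneg[OF sup0 dist_nonneg[of p p']]
      unfolding lip_norm_def distrib_right by linarith
    show "cmod (f p) \<le> nrm f" using sup[OF \<open>p \<in> P\<close>] L0 by (simp add: lip_norm_def)
  qed (use K in \<open>simp add: bnd_zero\<close>)
qed

lemma nrm_le:
  assumes "bnd K f" shows "nrm f \<le> 2 * K"
proof -
  have "lip_seminorm \<theta> P f \<le> K" unfolding lip_seminorm_def
    using assms by (intro cInf_lower) (auto simp: bnd_def lip_on_def intro!: bdd_belowI[of _ 0])
  moreover have "sup_norm P f \<le> K" unfolding sup_norm_def
    using assms nonempty by (intro cSUP_least) (auto intro: bnd_sup)
  ultimately show ?thesis by (simp add: lip_norm_def)
qed

lemma nrm_nonneg: "f \<in> F \<Longrightarrow> 0 \<le> nrm f"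
  using bnd_nrm bnd_nonneg by blast

lemma F_lincomb: "f \<in> F \<Longrightarrow> g \<in> F \<Longrightarrow> (\<lambda>p. a * f p + b * g p) \<in> F"
  using bnd_add bnd_scale unfolding lip_space_iff_bnd by meson

text \<open>\<open>bounded_op\<close> with its constant exposed: input measured by
  \<open>nrm\<close>, output by \<open>bnd\<close>, so that the values and differences of
  \<open>T \<phi>\<close> can be estimated directly.\<close>

definition bop :: "real \<Rightarrow> 'v operator \<Rightarrow> bool" where
  "bop C T \<longleftrightarrow> 0 \<le> C \<and>
     (\<forall>\<phi>\<in>F. \<forall>\<psi>\<in>F. \<forall>a b. T (\<lambda>p. a * \<phi> p + b * \<psi> p) = (\<lambda>p. a * T \<phi> p + b * T \<psi> p)) \<and>
     (\<forall>\<phi>\<in>F. bnd (C * nrm \<phi>) (T \<phi>))"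

lemma bopI:
  assumes "0 \<le> C"
    "\<And>\<phi> \<psi> a b p. \<phi> \<in> F \<Longrightarrow> \<psi> \<in> F \<Longrightarrow> T (\<lambda>p. a * \<phi> p + b * \<psi> p) p = a * T \<phi> p + b * T \<psi> p"
    "\<And>\<phi>. \<phi> \<in> F \<Longrightarrow> bnd (C * nrm \<phi>) (T \<phi>)"
  shows "bop C T"
  using assms by (auto simp: bop_def)

lemma bop_lin:
  "bop C T \<Longrightarrow> \<phi> \<in> F \<Longrightarrow> \<psi> \<in> F \<Longrightarrow> T (\<lambda>p. a * \<phi> p + b * \<psi> p) p = a * T \<phi> p + b * T \<psi> p"
  by (simp add: bop_def)

lemma bop_bnd: "bop C T \<Longrightarrow> \<phi> \<in> F \<Longrightarrow> bnd (C * nrm \<phi>) (T \<phi>)"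
  by (simp add: bop_def)

lemma bop_nonneg: "bop C T \<Longrightarrow> 0 \<le> C"
  by (simp add: bop_def)

lemma bop_mem: "bop C T \<Longrightarrow> \<phi> \<in> F \<Longrightarrow> T \<phi> \<in> F"
  using bop_bnd lip_space_iff_bnd by blast

lemma bop_mono: "bop C T \<Longrightarrow> C \<le> C' \<Longrightarrow> bop C' T"
  by (rule bopI) (auto simp: bop_lin dest: bop_nonneg
      intro!: bnd_mono[OF bop_bnd[of C T]] mult_right_mono nrm_nonneg)

lemma bop_cong: "bop C T \<Longrightarrow> (\<And>\<phi>. \<phi> \<in> F \<Longrightarrow> T' \<phi> = T \<phi>) \<Longrightarrow> bop C T'"
  unfolding bop_def by (simp add: F_lincomb)

lemma bop_add:
  assumes "bop C T" "bop C' T'" shows "bop (C + C') (\<lambda>\<phi> p. T \<phi> p + T' \<phi> p)"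
proof (rule bopI)
  show "bnd ((C + C') * nrm \<phi>) (\<lambda>p. T \<phi> p + T' \<phi> p)" if "\<phi> \<in> F" for \<phi>
    using bnd_add[OF bop_bnd[OF assms(1) that] bop_bnd[OF assms(2) that]] by (simp add: distrib_right)
qed (use assms in \<open>auto simp: bop_lin bop_nonneg algebra_simps\<close>)

lemma bop_scale:
  assumes "bop C T" shows "bop (cmod c * C) (\<lambda>\<phi> p. c * T \<phi> p)"
proof (rule bopI)
  show "bnd (cmod c * C * nrm \<phi>) (\<lambda>p. c * T \<phi> p)" if "\<phi> \<in> F" for \<phi>
    using bnd_scale[OF bop_bnd[OF assms that]] by (simp add: mult.assoc)
qed (use assms in \<open>auto simp: bop_lin bop_nonneg algebra_simps\<close>)

lemma bop_compose:
  assumes "bop C T" and X: "\<And>K f. bnd K f \<Longrightarrow> bnd (C' * K) (X f)" and "0 \<le> C'"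
    and lin: "\<And>f g a b. f \<in> F \<Longrightarrow> g \<in> F \<Longrightarrow> X (\<lambda>p. a * f p + b * g p) = (\<lambda>p. a * X f p + b * X g p)"
  shows "bop (C' * C) (\<lambda>\<phi>. X (T \<phi>))"
proof (rule bopI)
  show "bnd (C' * C * nrm \<phi>) (X (T \<phi>))" if "\<phi> \<in> F" for \<phi>
    using X[OF bop_bnd[OF assms(1) that]] by (simp add: mult.assoc)
  fix \<phi> \<psi> a b p assume "\<phi> \<in> F" "\<psi> \<in> F"
  then show "X (T (\<lambda>p. a * \<phi> p + b * \<psi> p)) p = a * X (T \<phi>) p + b * X (T \<psi>) p"
    using assms(1) bop_mem[OF assms(1)] lin by (simp add: bop_def)
qed (use assms bop_nonneg in auto)

lemma bop_id: "bop 1 (\<lambda>\<phi>. \<phi>)"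
  by (rule bopI) (auto simp: bnd_nrm)

lemma bop_zero: "bop 0 (\<lambda>\<phi> p. 0)"
  by (rule bopI) auto

lemma bounded_op_iff: "bounded_op \<theta> P T \<longleftrightarrow> (\<exists>C. bop C T)"
proof
  assume T: "bounded_op \<theta> P T"
  then obtain C where C: "\<And>\<phi>. \<phi> \<in> F \<Longrightarrow> nrm (T \<phi>) \<le> C * nrm \<phi>"
    unfolding bounded_op_def by blast
  have "bop \<bar>C\<bar> T"
  proof (rule bopI)
    fix \<phi> assume \<phi>: "\<phi> \<in> F"
    then have "T \<phi> \<in> F" using T by (simp add: bounded_op_def)
    moreover have "C * nrm \<phi> \<le> \<bar>C\<bar> * nrm \<phi>" by (intro mult_right_mono nrm_nonneg \<phi>) simp
    ultimately show "bnd (\<bar>C\<bar> * nrm \<phi>) (T \<phi>)"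
      using C[OF \<phi>] by (intro bnd_mono[OF bnd_nrm]) auto
  qed (use T in \<open>auto simp: bounded_op_def\<close>)
  then show "\<exists>C. bop C T" by blast
next
  assume "\<exists>C. bop C T"
  then obtain C where C: "bop C T" by blast
  have "nrm (T \<phi>) \<le> 2 * C * nrm \<phi>" if "\<phi> \<in> F" for \<phi>
    using nrm_le[OF bop_bnd[OF C that]] by (simp add: mult.assoc)
  then show "bounded_op \<theta> P T"
    using bop_mem[OF C] C unfolding bounded_op_def by (auto simp: bop_def)
qed

lemma op_norm_le:
  assumes "bop C T" shows "op_norm \<theta> P T \<le> 2 * C" "0 \<le> op_norm \<theta> P T"
proof -
  have z: "(\<lambda>_. 0) \<in> F" using bnd_0 lip_space_iff_bnd by blast
  \<comment> \<open>For \<open>nrm \<phi> = 0\<close> the quotient is 0 by the convention on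
    division, so the zero function may stay in the supremum; it also makes the supremum
    nonnegative.\<close>
  have b: "nrm (T \<phi>) / nrm \<phi> \<le> 2 * C" if "\<phi> \<in> F" for \<phi>
  proof (cases "nrm \<phi> = 0")
    case False
    then have "0 < nrm \<phi>" using nrm_nonneg[OF that] by linarith
    then show ?thesis using nrm_le[OF bop_bnd[OF assms that]] by (simp add: field_simps)
  qed (use bop_nonneg[OF assms] in simp)
  show "op_norm \<theta> P T \<le> 2 * C"
    unfolding op_norm_def using z b by (intro cSUP_least) auto
  have "0 \<le> nrm (T (\<lambda>_. 0)) / nrm (\<lambda>_. 0)"
    using z bop_mem[OF assms z] nrm_nonneg by simp
  also have "\<dots> \<le> op_norm \<theta> P T"
    unfolding op_norm_def using b z by (intro cSUP_upper) (auto intro!: bdd_aboveI[of _ "2 * C"])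
  finally show "0 \<le> op_norm \<theta> P T" .
qed

section \<open>Holomorphic families of operators\<close>

text \<open>
  Pointwise holomorphy together with a uniform operator bound implies holomorphy in the operator
  norm: the Cauchy estimates apply to \<open>w \<mapsto> M w \<phi> p\<close> and to
  \<open>w \<mapsto> M w \<phi> p - M w \<phi> p'\<close> alike.
\<close>

definition fam :: "complex \<Rightarrow> real \<Rightarrow> real \<Rightarrow> (complex \<Rightarrow> 'v operator) \<Rightarrow> bool" where
  "fam s r C M \<longleftrightarrow> 0 < r \<and> (\<forall>w\<in>ball s r. bop C (M w)) \<and>
     (\<forall>\<phi>\<in>F. \<forall>p. (\<lambda>w. M w \<phi> p) holomorphic_on ball s r)"

definition hol_at :: "complex \<Rightarrow> (complex \<Rightarrow> 'v operator) \<Rightarrow> bool" where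
  "hol_at s M \<longleftrightarrow> (\<exists>r C. fam s r C M)"

text \<open>The removable singularity at \<open>w = s\<close> is filled by the derivative, so the
  divided difference is again a holomorphic family; iterating it peels off Taylor
  coefficients.\<close>

definition diff_quot :: "complex \<Rightarrow> (complex \<Rightarrow> 'v operator) \<Rightarrow> complex \<Rightarrow> 'v operator" where
  "diff_quot s M w \<phi> p =
     (if w = s then deriv (\<lambda>w. M w \<phi> p) s else (M w \<phi> p - M s \<phi> p) / (w - s))"

lemma fam_subset:
  assumes "fam s r C M" "ball s' r' \<subseteq> ball s r" "0 < r'"
  shows "fam s' r' C M"
  using assms unfolding fam_def by (auto intro: holomorphic_on_subset[OF _ assms(2)])

lemma fam_diff:
  assumes "fam s r C M" and w: "w \<in> ball s (r/2)"
  shows "bop (4 * C / r * cmod (w - s)) (\<lambda>\<phi> p. M w \<phi> p - M s \<phi> p)"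
proof (rule bopI)
  have r: "0 < r" and b: "\<And>w. w \<in> ball s r \<Longrightarrow> bop C (M w)"
    and h: "\<And>\<phi> p. \<phi> \<in> F \<Longrightarrow> (\<lambda>w. M w \<phi> p) holomorphic_on ball s r"
    using assms(1) by (auto simp: fam_def)
  have ws: "w \<in> ball s r" "s \<in> ball s r" using w r by auto
  have C: "0 \<le> C" using b[OF ws(2)] bop_nonneg by blast
  then show "0 \<le> 4 * C / r * cmod (w - s)" using r by simp
  show "M w (\<lambda>p. a * \<phi> p + b * \<psi> p) p - M s (\<lambda>p. a * \<phi> p + b * \<psi> p) p
        = a * (M w \<phi> p - M s \<phi> p) + b * (M w \<psi> p - M s \<psi> p)"
    if "\<phi> \<in> F" "\<psi> \<in> F" for \<phi> \<psi> a b p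
    using bop_lin[OF b[OF ws(1)] that] bop_lin[OF b[OF ws(2)] that] by (simp add: algebra_simps)
  fix \<phi> assume \<phi>: "\<phi> \<in> F"
  show "bnd (4 * C / r * cmod (w - s) * nrm \<phi>) (\<lambda>p. M w \<phi> p - M s \<phi> p)"
  proof (rule bndI)
    fix p
    show "M w \<phi> p - M s \<phi> p = 0" if "p \<notin> P"
      using bnd_zero[OF bop_bnd[OF b[OF ws(1)] \<phi>] that] bnd_zero[OF bop_bnd[OF b[OF ws(2)] \<phi>] that]
      by simp
    have "cmod (M w \<phi> p - M s \<phi> p) \<le> 4 * (C * nrm \<phi>) / r * cmod (w - s)"
      using h[OF \<phi>] r bnd_sup[OF bop_bnd[OF b \<phi>]] w by (rule holomorphic_lipschitz_at_center)
    then show "cmod (M w \<phi> p - M s \<phi> p) \<le> 4 * C / r * cmod (w - s) * nrm \<phi>"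
      by (simp add: mult_ac)
    fix p' assume p: "p \<in> P" "p' \<in> P"
    have "cmod ((M w \<phi> p - M w \<phi> p') - (M s \<phi> p - M s \<phi> p'))
        \<le> 4 * (C * nrm \<phi> * path_dist \<theta> p p') / r * cmod (w - s)"
      using h[OF \<phi>] r bnd_lip[OF bop_bnd[OF b \<phi>] p] w
      by (intro holomorphic_lipschitz_at_center holomorphic_on_diff) auto
    then show "cmod ((M w \<phi> p - M s \<phi> p) - (M w \<phi> p' - M s \<phi> p'))
        \<le> 4 * C / r * cmod (w - s) * nrm \<phi> * path_dist \<theta> p p'"
      by (simp add: algebra_simps)
  qed
qed

lemma fam_deriv:
  assumes "fam s r C M"
  shows "bop (2 * C / r) (diff_quot s M s)"
proof (rule bopI)
  have r: "0 < r" and b: "\<And>w. w \<in> ball s r \<Longrightarrow> bop C (M w)"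
    and h: "\<And>\<phi> p. \<phi> \<in> F \<Longrightarrow> (\<lambda>w. M w \<phi> p) holomorphic_on ball s r"
    using assms by (auto simp: fam_def)
  have s: "s \<in> ball s r" using r by auto
  have D: "((\<lambda>w. M w \<phi> p) has_field_derivative diff_quot s M s \<phi> p) (at s)" if "\<phi> \<in> F" for \<phi> p
    using h[OF that, of p] s by (auto simp: diff_quot_def intro: holomorphic_derivI)
  have ev: "\<forall>\<^sub>F w in nhds s. w \<in> ball s r"
    using s by (intro eventually_nhds_in_open) auto
  show "0 \<le> 2 * C / r" using b[OF s] bop_nonneg r by auto
  show "diff_quot s M s (\<lambda>p. a * \<phi> p + b * \<psi> p) p = a * diff_quot s M s \<phi> p + b * diff_quot s M s \<psi> p"
    if "\<phi> \<in> F" "\<psi> \<in> F" for \<phi> \<psi> a b p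
  proof -
    have "\<forall>\<^sub>F w in nhds s. M w (\<lambda>p. a * \<phi> p + b * \<psi> p) p = a * M w \<phi> p + b * M w \<psi> p"
      using ev by eventually_elim (rule bop_lin[OF b that])
    then have "diff_quot s M s (\<lambda>p. a * \<phi> p + b * \<psi> p) p = deriv (\<lambda>w. a * M w \<phi> p + b * M w \<psi> p) s"
      unfolding diff_quot_def by (simp cong: deriv_cong_ev)
    also have "\<dots> = a * diff_quot s M s \<phi> p + b * diff_quot s M s \<psi> p"
      using D[OF that(1), of p] D[OF that(2), of p]
      by (intro DERIV_imp_deriv) (auto intro!: derivative_eq_intros)
    finally show ?thesis .
  qed
  fix \<phi> assume \<phi>: "\<phi> \<in> F"
  show "bnd (2 * C / r * nrm \<phi>) (diff_quot s M s \<phi>)"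
  proof (rule bndI)
    fix p
    show "diff_quot s M s \<phi> p = 0" if "p \<notin> P"
    proof -
      have "\<forall>\<^sub>F w in nhds s. M w \<phi> p = 0"
        using ev by eventually_elim (rule bnd_zero[OF bop_bnd[OF b \<phi>] that])
      then show ?thesis unfolding diff_quot_def by (simp cong: deriv_cong_ev)
    qed
    have "cmod (deriv (\<lambda>w. M w \<phi> p) s) \<le> 2 * (C * nrm \<phi>) / r"
      using h[OF \<phi>] r bnd_sup[OF bop_bnd[OF b \<phi>]] by (rule deriv_bound_ball)
    then show "cmod (diff_quot s M s \<phi> p) \<le> 2 * C / r * nrm \<phi>"
      by (simp add: diff_quot_def mult_ac)
    fix p' assume p: "p \<in> P" "p' \<in> P"
    have "cmod (deriv (\<lambda>w. M w \<phi> p - M w \<phi> p') s) \<le> 2 * (C * nrm \<phi> * path_dist \<theta> p p') / r"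
      using h[OF \<phi>] r bnd_lip[OF bop_bnd[OF b \<phi>] p]
      by (intro deriv_bound_ball holomorphic_on_diff) auto
    moreover have "deriv (\<lambda>w. M w \<phi> p - M w \<phi> p') s = diff_quot s M s \<phi> p - diff_quot s M s \<phi> p'"
      using D[OF \<phi>] by (intro DERIV_imp_deriv derivative_intros)
    ultimately show "cmod (diff_quot s M s \<phi> p - diff_quot s M s \<phi> p')
        \<le> 2 * C / r * nrm \<phi> * path_dist \<theta> p p'"
      by (simp add: mult_ac)
  qed
qed

text \<open>The factor \<open>cmod (w - s)\<close> of \<open>fam_diff\<close> cancels the
  denominator, so one operator bound serves all \<open>w\<close>; the centre is covered by
  \<open>fam_deriv\<close>.\<close>

lemma fam_diff_quot:
  assumes "fam s r C M" shows "fam s (r/2) (4 * C / r) (diff_quot s M)"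
  unfolding fam_def
proof (intro conjI ballI allI)
  have r: "0 < r" and b: "\<And>w. w \<in> ball s r \<Longrightarrow> bop C (M w)" using assms by (auto simp: fam_def)
  then have C: "0 \<le> C" using bop_nonneg[of C "M s"] by auto
  show "0 < r/2" using r by simp
  fix w assume w: "w \<in> ball s (r/2)"
  show "bop (4 * C / r) (diff_quot s M w)"
  proof (cases "w = s")
    case True
    then show ?thesis using bop_mono[OF fam_deriv[OF assms]] r C by (simp add: divide_right_mono)
  next
    case False
    have "bop (cmod (1 / (w - s)) * (4 * C / r * cmod (w - s)))
        (\<lambda>\<phi> p. 1 / (w - s) * (M w \<phi> p - M s \<phi> p))"
      by (intro bop_scale fam_diff[OF assms w])
    then have "bop (4 * C / r) (\<lambda>\<phi> p. 1 / (w - s) * (M w \<phi> p - M s \<phi> p))"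
      using False by (simp add: norm_divide)
    then show ?thesis by (rule bop_cong) (use False in \<open>auto simp: diff_quot_def\<close>)
  qed
next
  fix \<phi> p assume "\<phi> \<in> F"
  then have "(\<lambda>w. M w \<phi> p) holomorphic_on ball s r" "0 < r"
    using assms by (auto simp: fam_def)
  then have "(\<lambda>w. M w \<phi> p) holomorphic_on ball s (r/2)"
    by (auto elim: holomorphic_on_subset)
  then show "(\<lambda>w. diff_quot s M w \<phi> p) holomorphic_on ball s (r/2)"
    unfolding diff_quot_def by (intro pole_lemma_open) auto
qed

lemma hol_at_diff_quot: "hol_at s M \<Longrightarrow> hol_at s (diff_quot s M)"
  unfolding hol_at_def using fam_diff_quot by blast

lemma hol_at_bop: "hol_at s M \<Longrightarrow> \<exists>C. bop C (M s)"
  unfolding hol_at_def fam_def by (meson centre_in_ball)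

lemma hol_at_nearby: "hol_at s M \<Longrightarrow> \<exists>r>0. \<forall>w\<in>ball s r. hol_at w M"
proof -
  assume "hol_at s M"
  then obtain r C where f: "fam s r C M" by (auto simp: hol_at_def)
  have "hol_at w M" if "w \<in> ball s r" for w
  proof -
    obtain e where "0 < e" "ball w e \<subseteq> ball s r"
      using \<open>w \<in> ball s r\<close> open_contains_ball by blast
    then show ?thesis using fam_subset[OF f] unfolding hol_at_def by blast
  qed
  then show ?thesis using f by (auto simp: fam_def)
qed

lemma hol_at_cong:
  assumes "hol_at s M" "0 < r" "\<And>w \<phi>. w \<in> ball s r \<Longrightarrow> \<phi> \<in> F \<Longrightarrow> M' w \<phi> = M w \<phi>"
  shows "hol_at s M'"
proof -
  obtain r1 C where f: "fam s r1 C M" using assms(1) by (auto simp: hol_at_def)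
  then have f': "fam s (min r r1) C M" using assms(2) by (intro fam_subset[OF f]) (auto simp: fam_def)
  have "fam s (min r r1) C M'"
    unfolding fam_def
  proof (intro conjI ballI allI)
    show "0 < min r r1" using f' by (simp add: fam_def)
    show "bop C (M' w)" if w: "w \<in> ball s (min r r1)" for w
      by (rule bop_cong[of C "M w"]) (use f' w assms(3) in \<open>auto simp: fam_def\<close>)
    show "(\<lambda>w. M' w \<phi> p) holomorphic_on ball s (min r r1)" if "\<phi> \<in> F" for \<phi> p
    proof -
      have "(\<lambda>w. M w \<phi> p) holomorphic_on ball s (min r r1)" using f' that by (auto simp: fam_def)
      then show ?thesis by (rule holomorphic_transform) (use that assms(3) in auto)
    qed
  qed
  then show ?thesis by (auto simp: hol_at_def)
qed

lemma hol_at_common_ball: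
  assumes "hol_at s M" "hol_at s M'" "open U" "s \<in> U"
  obtains r C C' where "fam s r C M" "fam s r C' M'" "cball s r \<subseteq> U"
proof -
  obtain r1 C r2 C' where f: "fam s r1 C M" "fam s r2 C' M'"
    using assms by (auto simp: hol_at_def)
  obtain r3 where r3: "r3 > 0" "cball s r3 \<subseteq> U" using assms(3,4) open_contains_cball by blast
  have r12: "0 < r1" "0 < r2" using f by (auto simp: fam_def)
  define r where "r = min r3 (min r1 r2)"
  have "fam s r C M" "fam s r C' M'" "cball s r \<subseteq> U"
    using r3 r12 by (auto simp: r_def intro!: fam_subset[OF f(1)] fam_subset[OF f(2)])
  then show ?thesis using that by blast
qed

section \<open>Algebra of holomorphic families\<close>

lemma hol_at_add:
  assumes "hol_at s M" "hol_at s M'"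
  shows "hol_at s (\<lambda>w \<phi> p. M w \<phi> p + M' w \<phi> p)"
proof -
  obtain r C C' where "fam s r C M" "fam s r C' M'"
    by (rule hol_at_common_ball[OF assms open_UNIV UNIV_I])
  then have "fam s r (C + C') (\<lambda>w \<phi> p. M w \<phi> p + M' w \<phi> p)"
    unfolding fam_def by (simp add: bop_add holomorphic_on_add)
  then show ?thesis by (auto simp: hol_at_def)
qed

lemma hol_at_scale:
  assumes "hol_at s M" "f holomorphic_on U" "open U" "s \<in> U"
  shows "hol_at s (\<lambda>w \<phi> p. f w * M w \<phi> p)"
proof -
  obtain r C where f: "fam s r C M" "cball s r \<subseteq> U"
    by (rule hol_at_common_ball[OF assms(1,1,3,4)])
  then have r: "0 < r" by (simp add: fam_def)
  have hol: "f holomorphic_on cball s r" using assms(2) f(2) holomorphic_on_subset by blast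
  then have "compact (f ` cball s r)"
    by (intro compact_continuous_image holomorphic_on_imp_continuous_on) auto
  then obtain B where B: "\<And>w. w \<in> cball s r \<Longrightarrow> cmod (f w) \<le> B"
    using compact_imp_bounded bounded_iff by (metis imageI)
  have "fam s r (B * C) (\<lambda>w \<phi> p. f w * M w \<phi> p)"
    unfolding fam_def
  proof (intro conjI ballI allI)
    fix w assume w: "w \<in> ball s r"
    then have "bop C (M w)" using f(1) by (simp add: fam_def)
    then show "bop (B * C) (\<lambda>\<phi> p. f w * M w \<phi> p)"
      using B[of w] w by (intro bop_mono[OF bop_scale]) (auto intro!: mult_right_mono bop_nonneg)
  next
    fix \<phi> p assume "\<phi> \<in> F"
    then show "(\<lambda>w. f w * M w \<phi> p) holomorphic_on ball s r"
      using f(1) hol unfolding fam_def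
      by (intro holomorphic_on_mult) (auto intro: holomorphic_on_subset)
  qed (fact r)
  then show ?thesis by (auto simp: hol_at_def)
qed

lemma hol_at_const: "bop C T \<Longrightarrow> hol_at s (\<lambda>_. T)"
  unfolding hol_at_def fam_def by (intro exI[of _ 1] exI[of _ C]) auto

lemma hol_at_sum:
  assumes "finite I" "\<And>i. i \<in> I \<Longrightarrow> hol_at s (M i)"
  shows "hol_at s (\<lambda>w \<phi> p. \<Sum>i\<in>I. M i w \<phi> p)"
  using assms
proof (induction I)
  case empty
  then show ?case using hol_at_const[OF bop_zero] by simp
next
  case (insert i I)
  then show ?case using hol_at_add[of s "M i" "\<lambda>w \<phi> p. \<Sum>i\<in>I. M i w \<phi> p"] by simp
qed

text \<open>Meant for \<open>E\<close> and \<open>L\<close>: each of their values is a finite linear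
  combination of values of the argument, which gives the last hypothesis.\<close>

lemma hol_at_compose:
  assumes "hol_at s M" and X: "\<And>K f. bnd K f \<Longrightarrow> bnd (C' * K) (X f)" "0 \<le> C'"
    "\<And>f g a b. f \<in> F \<Longrightarrow> g \<in> F \<Longrightarrow> X (\<lambda>p. a * f p + b * g p) = (\<lambda>p. a * X f p + b * X g p)"
    and hol: "\<And>g U p. (\<And>p. (\<lambda>w. g w p) holomorphic_on U) \<Longrightarrow> (\<lambda>w. X (g w) p) holomorphic_on U"
  shows "hol_at s (\<lambda>w \<phi>. X (M w \<phi>))"
proof -
  obtain r C where "fam s r C M" using assms(1) by (auto simp: hol_at_def)
  then have "fam s r (C' * C) (\<lambda>w \<phi>. X (M w \<phi>))"
    unfolding fam_def
    by (elim conjE, intro conjI ballI allI bop_compose[where X = X and C' = C', OF _ X] hol) auto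
  then show ?thesis by (auto simp: hol_at_def)
qed

text \<open>The Lipschitz estimate is applied a second time, to the divided differences: their
  distance from their value at \<open>s\<close>, the candidate derivative, is of order
  \<open>cmod (w - s)\<close>.\<close>

lemma op_holomorphic_onI:
  assumes "\<And>s. s \<in> U \<Longrightarrow> hol_at s M"
  shows "op_holomorphic_on \<theta> P M U"
  unfolding op_holomorphic_on_def
proof (intro conjI ballI)
  fix s assume "s \<in> U"
  then have "hol_at s M" using assms by blast
  then show "bounded_op \<theta> P (M s)" using hol_at_bop bounded_op_iff by blast
  obtain r C where f: "fam s r C M" using \<open>hol_at s M\<close> by (auto simp: hol_at_def)
  let ?D = "diff_quot s M s"
  let ?N = "\<lambda>w. op_norm \<theta> P (\<lambda>\<phi> p. (M w \<phi> p - M s \<phi> p) / (w - s) - ?D \<phi> p)"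
  \<comment> \<open>The constant of \<open>fam_diff\<close> for the family
    \<open>diff_quot s M\<close>, which has bound \<open>4 * C / r\<close> on radius
    \<open>r/2\<close>, doubled by \<open>op_norm_le\<close>.\<close>
  define B where "B = 2 * (4 * (4 * C / r) / (r/2))"
  have r: "0 < r" using f by (simp add: fam_def)
  have le: "?N w \<le> B * cmod (w - s) \<and> 0 \<le> ?N w" if "w \<in> ball s (r/2/2)" "w \<noteq> s" for w
  proof -
    let ?T = "\<lambda>\<phi> p. (M w \<phi> p - M s \<phi> p) / (w - s) - ?D \<phi> p"
    have eq: "?T = (\<lambda>\<phi> p. diff_quot s M w \<phi> p - ?D \<phi> p)"
      using that by (simp add: diff_quot_def)
    have "bop (4 * (4 * C / r) / (r/2) * cmod (w - s)) ?T"
      unfolding eq using fam_diff[OF fam_diff_quot[OF f] that(1)] .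
    from op_norm_le[OF this] show ?thesis by (simp add: B_def mult.assoc)
  qed
  have "\<forall>\<^sub>F w in at s within U. w \<in> ball s (r/2/2) \<and> w \<noteq> s"
    using r by (auto simp: eventually_at dist_commute intro!: exI[of _ "r/2/2"])
  then have ev: "\<forall>\<^sub>F w in at s within U. norm (?N w) \<le> B * cmod (w - s)"
    by eventually_elim (use le in auto)
  have "((\<lambda>w. B * cmod (w - s)) \<longlongrightarrow> B * cmod (s - s)) (at s within U)"
    by (intro tendsto_intros)
  then have "((\<lambda>w. B * cmod (w - s)) \<longlongrightarrow> 0) (at s within U)" by simp
  then have "(?N \<longlongrightarrow> 0) (at s within U)" by (rule Lim_null_comparison[OF ev])
  moreover have "bounded_op \<theta> P ?D" using fam_deriv[OF f] bounded_op_iff by blast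
  ultimately show "\<exists>D. bounded_op \<theta> P D \<and>
      ((\<lambda>w. op_norm \<theta> P (\<lambda>\<phi> p. (M w \<phi> p - M s \<phi> p) / (w - s) - D \<phi> p)) \<longlongrightarrow> 0) (at s within U)"
    by blast
qed

text \<open>
  A subspace of functions is given as the fixed points of pulling back along \<open>\<rho>\<close>; such a
  subspace is closed under pointwise limits and hence contains the Laurent coefficients.
\<close>

definition laurent_at ::
    "('v edge_seq \<Rightarrow> 'v edge_seq) \<Rightarrow> complex \<Rightarrow> nat \<Rightarrow> (complex \<Rightarrow> 'v operator) \<Rightarrow>
     (nat \<Rightarrow> 'v operator) \<Rightarrow> (complex \<Rightarrow> 'v operator) \<Rightarrow> bool" where
  "laurent_at \<rho> s N G A H \<longleftrightarrow>
     (\<forall>j\<in>{1..N}. (\<exists>C. bop C (A j)) \<and> (\<forall>\<phi>. \<forall>p\<in>P. A j \<phi> (\<rho> p) = A j \<phi> p)) \<and> hol_at s H \<and>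
     (\<forall>w \<phi> p. w \<noteq> s \<longrightarrow>
        G w \<phi> p / (w - s) ^ N = (\<Sum>j=1..N. A j \<phi> p / (w - s) ^ j) + H w \<phi> p)"

text \<open>Dividing \<open>G w = G s + (w - s) * diff_quot s G w\<close> by the power
  \<open>Suc N\<close> leaves \<open>G s\<close> as top coefficient and the same problem for the
  divided difference with one power less.\<close>

lemma laurent_at_Suc:
  assumes "hol_at s G" "\<forall>w \<phi>. \<forall>p\<in>P. G w \<phi> (\<rho> p) = G w \<phi> p"
    and "laurent_at \<rho> s N (diff_quot s G) A H"
  shows "laurent_at \<rho> s (Suc N) G (A(Suc N := G s)) H"
proof -
  define A' where "A' = A(Suc N := G s)"
  have A: "(\<exists>C. bop C (A j)) \<and> (\<forall>\<phi>. \<forall>p\<in>P. A j \<phi> (\<rho> p) = A j \<phi> p)" if "j \<in> {1..N}" for j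
    using assms(3) that by (simp add: laurent_at_def)
  have A': "(\<exists>C. bop C (A' j)) \<and> (\<forall>\<phi>. \<forall>p\<in>P. A' j \<phi> (\<rho> p) = A' j \<phi> p)" if "j \<in> {1..Suc N}" for j
  proof (cases "j = Suc N")
    case True
    then show ?thesis using hol_at_bop[OF assms(1)] assms(2) by (simp add: A'_def)
  next
    case False
    then show ?thesis using A[of j] that by (simp add: A'_def)
  qed
  have "G w \<phi> p / (w - s) ^ Suc N = (\<Sum>j=1..Suc N. A' j \<phi> p / (w - s) ^ j) + H w \<phi> p"
    if "w \<noteq> s" for w \<phi> p
  proof -
    have ws: "w - s \<noteq> 0" using that by simp
    have "G w \<phi> p = G s \<phi> p + (w - s) * diff_quot s G w \<phi> p"
      using that by (simp add: diff_quot_def)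
    then have "G w \<phi> p / (w - s) ^ Suc N
        = G s \<phi> p / (w - s) ^ Suc N + diff_quot s G w \<phi> p / (w - s) ^ N"
      using ws by (simp add: add_divide_distrib)
    also have "diff_quot s G w \<phi> p / (w - s) ^ N = (\<Sum>j=1..N. A j \<phi> p / (w - s) ^ j) + H w \<phi> p"
      using assms(3) that by (simp add: laurent_at_def)
    also have "(\<Sum>j=1..N. A j \<phi> p / (w - s) ^ j) = (\<Sum>j=1..N. A' j \<phi> p / (w - s) ^ j)"
      by (rule sum.cong) (auto simp: A'_def)
    finally show ?thesis by (simp add: A'_def)
  qed
  then show ?thesis using A' assms(3) unfolding laurent_at_def A'_def[symmetric] by simp
qed

lemma laurent_expansion:
  assumes "hol_at s G" "\<forall>w \<phi>. \<forall>p\<in>P. G w \<phi> (\<rho> p) = G w \<phi> p"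
  shows "\<exists>A H. laurent_at \<rho> s N G A H"
  using assms
proof (induction N arbitrary: G)
  case 0
  then show ?case by (auto simp: laurent_at_def)
next
  case (Suc N)
  \<comment> \<open>This includes \<open>w = s\<close>: the values at \<open>\<rho> p\<close> and at
    \<open>p\<close> are the same function of \<open>w\<close>, so their derivatives agree.\<close>
  have "\<forall>w \<phi>. \<forall>p\<in>P. diff_quot s G w \<phi> (\<rho> p) = diff_quot s G w \<phi> p"
    using Suc.prems(2) by (simp add: diff_quot_def)
  from Suc.IH[OF hol_at_diff_quot[OF Suc.prems(1)] this] show ?case
    using laurent_at_Suc[OF Suc.prems] by blast
qed

lemma has_principal_partI:
  assumes "1 \<le> N" "\<And>j. j \<in> {1..N} \<Longrightarrow> \<exists>C. bop C (A j)" "\<phi> \<in> F" "A N \<phi> \<noteq> (\<lambda>_. 0)" "hol_at s H" "0 < r"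
    and eq: "\<And>w \<phi>. w \<in> ball s r - {s} \<Longrightarrow> \<phi> \<in> F \<Longrightarrow>
      M w \<phi> = (\<lambda>p. (\<Sum>j=1..N. A j \<phi> p / (w - s) ^ j) + H w \<phi> p)"
  shows "has_principal_part \<theta> P M s N A"
proof -
  obtain r' where r': "0 < r'" "\<And>w. w \<in> ball s r' \<Longrightarrow> hol_at w H"
    using hol_at_nearby[OF assms(5)] by blast
  have "op_holomorphic_on \<theta> P H (ball s (min r r'))"
    by (intro op_holomorphic_onI r') auto
  moreover have "\<forall>w\<in>ball s (min r r') - {s}. \<forall>\<phi>\<in>F.
      M w \<phi> = (\<lambda>p. (\<Sum>j=1..N. A j \<phi> p / (w - s) ^ j) + H w \<phi> p)"
    using eq by auto
  ultimately show ?thesis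
    unfolding has_principal_part_def using assms(1-4,6) r'(1)
    by (meson bounded_op_iff min_less_iff_conj)
qed

end

section \<open>The transfer operator of a locally constant weight\<close>

text \<open>\<open>step\<close> absorbs the orientation: for left-infinite paths it is
  \<open>admissible\<close> with exchanged arguments, and preimages under the shift prepend an edge
  in both cases. With \<open>n\<close> positive, agreement on \<open>n\<close> edges fixes the first
  edge and hence the edges that may be prepended.\<close>

locale weighted_shift = lipschitz_functions \<theta> P
  for \<theta> :: real and P :: "'v edge_seq set" +
  fixes A :: "('v \<times> 'v) set" and step :: "'v \<times> 'v \<Rightarrow> 'v \<times> 'v \<Rightarrow> bool"
    and q n :: nat and \<omega> :: "'v edge_seq \<Rightarrow> complex" and W :: real
  assumes finite_A: "finite A"
    and P_eq: "P = {p. \<forall>i. p i \<in> A \<and> step (p i) (p (Suc i))}"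
    and card_step: "\<And>b. b \<in> A \<Longrightarrow> card {a \<in> A. step a b} \<le> q"
    and pos: "0 < q" "0 < n" "0 < W"
    and weight_local: "\<And>p p'. p \<in> P \<Longrightarrow> p' \<in> P \<Longrightarrow> (\<And>i. i < n \<Longrightarrow> p i = p' i) \<Longrightarrow> \<omega> p = \<omega> p'"
    and weight_zero: "\<And>p. p \<notin> P \<Longrightarrow> \<omega> p = 0"
    and weight_le: "\<And>p. p \<in> P \<Longrightarrow> cmod (\<omega> p) \<le> W"
begin

abbreviation L where "L \<equiv> transfer_op P \<omega>"

lemma case_nat_mem: "p \<in> P \<Longrightarrow> a \<in> A \<Longrightarrow> step a (p 0) \<Longrightarrow> case_nat a p \<in> P"
  by (auto simp: P_eq split: nat.split)

text \<open>Indexing the preimages by the prepended edge makes the index set depend on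
  \<open>p 0\<close> only, so the sums at two paths in one cylinder can be compared term by
  term.\<close>

lemma L_eq:
  assumes "p \<in> P"
  shows "L f p = (\<Sum>a | a \<in> A \<and> step a (p 0). \<omega> (case_nat a p) * f (case_nat a p))"
proof -
  have "{p'. p' \<in> P \<and> shift p' = p} = (\<lambda>a. case_nat a p) ` {a. a \<in> A \<and> step a (p 0)}"
  proof (intro equalityI subsetI)
    fix p' assume "p' \<in> {p'. p' \<in> P \<and> shift p' = p}"
    then have p': "p' \<in> P" "p = (\<lambda>i. p' (Suc i))" by (auto simp: shift_def)
    then have "p' = case_nat (p' 0) p" by (auto simp: fun_eq_iff split: nat.split)
    moreover have "p' 0 \<in> A \<and> step (p' 0) (p 0)" using p' by (simp add: P_eq)
    ultimately show "p' \<in> (\<lambda>a. case_nat a p) ` {a. a \<in> A \<and> step a (p 0)}" by blast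
  qed (use assms case_nat_mem in \<open>auto simp: shift_def\<close>)
  moreover have "inj_on (\<lambda>a. case_nat a p) {a. a \<in> A \<and> step a (p 0)}"
    by (rule inj_onI) (metis old.nat.simps(4))
  ultimately show ?thesis by (simp add: transfer_op_def sum.reindex)
qed

lemma L_zero: "p \<notin> P \<Longrightarrow> L f p = 0"
proof -
  assume "p \<notin> P"
  then have "{p'. p' \<in> P \<and> shift p' = p} = {}" by (auto simp: P_eq shift_def)
  then show ?thesis unfolding transfer_op_def by (metis sum.empty)
qed

lemma L_lin: "L (\<lambda>p. a * f p + b * g p) = (\<lambda>p. a * L f p + b * L g p)"
  by (auto simp: transfer_op_def sum.distrib sum_distrib_left algebra_simps)

lemma Lk_lin: "(L ^^ k) (\<lambda>p. a * f p + b * g p) = (\<lambda>p. a * (L ^^ k) f p + b * (L ^^ k) g p)"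
  by (induction k) (simp_all add: L_lin)

lemma Lk_sum:
  assumes "finite S"
  shows "(L ^^ k) (\<lambda>p. \<Sum>i\<in>S. a i * h i p) = (\<lambda>p. \<Sum>i\<in>S. a i * (L ^^ k) (h i) p)"
  using assms
proof (induction S)
  case empty
  show ?case using Lk_lin[of k 0 "\<lambda>_. 0" 0 "\<lambda>_. 0"] by simp
next
  case (insert i S)
  then show ?case using Lk_lin[of k "a i" "h i" 1 "\<lambda>p. \<Sum>i\<in>S. a i * h i p"] by simp
qed

lemma norm_sum_step_le:
  assumes "p \<in> P" "0 \<le> B" "\<And>a. a \<in> A \<Longrightarrow> step a (p 0) \<Longrightarrow> cmod (h a) \<le> B"
  shows "cmod (\<Sum>a | a \<in> A \<and> step a (p 0). h a) \<le> real q * B"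
proof -
  have "cmod (\<Sum>a | a \<in> A \<and> step a (p 0). h a) \<le> real (card {a \<in> A. step a (p 0)}) * B"
    using assms by (intro sum_norm_bound) auto
  also have "\<dots> \<le> real q * B"
    using card_step[of "p 0"] assms(1,2) by (intro mult_right_mono) (auto simp: P_eq)
  finally show ?thesis .
qed

lemma L_sup:
  assumes "p \<in> P" "0 \<le> K" "\<And>p. p \<in> P \<Longrightarrow> cmod (f p) \<le> K"
  shows "cmod (L f p) \<le> real q * W * K"
proof -
  have "cmod (\<omega> (case_nat a p) * f (case_nat a p)) \<le> W * K" if "a \<in> A" "step a (p 0)" for a
    unfolding norm_mult using case_nat_mem[OF assms(1) that] pos
    by (intro mult_mono weight_le assms) auto
  then have "cmod (\<Sum>a | a \<in> A \<and> step a (p 0). \<omega> (case_nat a p) * f (case_nat a p)) \<le> real q * (W * K)"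
    using assms pos by (intro norm_sum_step_le) auto
  then show ?thesis using L_eq[OF assms(1)] by (simp add: mult.assoc)
qed

section \<open>The transfer operator at the scale of cylinders\<close>

definition agree :: "'v edge_seq \<Rightarrow> 'v edge_seq \<Rightarrow> bool" where
  "agree p p' \<longleftrightarrow> (\<forall>i<n. p i = p' i)"

lemma agree_0: "agree p p' \<Longrightarrow> p 0 = p' 0"
  using pos by (simp add: agree_def)

lemma agree_case_nat: "agree p p' \<Longrightarrow> agree (case_nat a p) (case_nat a p')"
  by (auto simp: agree_def split: nat.split)

lemma dist_not_agree: "\<not> agree p p' \<Longrightarrow> \<theta> ^ n \<le> path_dist \<theta> p p'"
  using path_dist_ge[OF theta] by (auto simp: agree_def)

text \<open>The Lipschitz constant at small scale; it controls the distance to the functions of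
  the first \<open>n\<close> edges.\<close>

definition loc_lip :: "real \<Rightarrow> ('v edge_seq \<Rightarrow> complex) \<Rightarrow> bool" where
  "loc_lip K f \<longleftrightarrow> 0 \<le> K \<and>
     (\<forall>p\<in>P. \<forall>p'\<in>P. agree p p' \<longrightarrow> cmod (f p - f p') \<le> K * path_dist \<theta> p p')"

lemma bnd_imp_loc_lip: "bnd K f \<Longrightarrow> loc_lip K f"
  by (simp add: loc_lip_def bnd_lip bnd_nonneg)

text \<open>The restriction to pairs in one cylinder is essential: elsewhere the weights and even
  the sets of prependable edges may differ, and the factor \<theta> is lost.\<close>

lemma loc_lip_L:
  assumes "loc_lip K f" shows "loc_lip (real q * W * \<theta> * K) (L f)"
  unfolding loc_lip_def
proof (intro conjI ballI impI)
  have K: "0 \<le> K" using assms by (simp add: loc_lip_def)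
  then show "0 \<le> real q * W * \<theta> * K" using pos theta by simp
  fix p p' assume p: "p \<in> P" "p' \<in> P" and ag: "agree p p'"
  let ?d = "path_dist \<theta> p p'"
  let ?h = "\<lambda>p a. \<omega> (case_nat a p) * f (case_nat a p)"
  have "cmod (?h p a - ?h p' a) \<le> W * \<theta> * K * ?d" if "a \<in> A" "step a (p 0)" for a
  proof -
    have m: "case_nat a p \<in> P" "case_nat a p' \<in> P"
      using case_nat_mem p that agree_0[OF ag] by auto
    have "\<omega> (case_nat a p) = \<omega> (case_nat a p')"
      using agree_case_nat[OF ag] by (intro weight_local m) (auto simp: agree_def)
    then have "cmod (?h p a - ?h p' a)
        = cmod (\<omega> (case_nat a p)) * cmod (f (case_nat a p) - f (case_nat a p'))"
      by (simp add: norm_mult flip: right_diff_distrib)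
    also have "\<dots> \<le> W * (K * (\<theta> * ?d))"
      using assms m agree_case_nat[OF ag, of a] pos
      unfolding path_dist_case_nat[symmetric, of \<theta> p p' a]
      by (intro mult_mono weight_le m) (auto simp: loc_lip_def)
    finally show ?thesis by (simp add: mult_ac)
  qed
  then have "cmod (\<Sum>a | a \<in> A \<and> step a (p 0). ?h p a - ?h p' a) \<le> real q * (W * \<theta> * K * ?d)"
    using K pos theta p by (intro norm_sum_step_le) auto
  then show "cmod (L f p - L f p') \<le> real q * W * \<theta> * K * ?d"
    using agree_0[OF ag] by (simp add: L_eq[OF p(1)] L_eq[OF p(2)] sum_subtractf mult.assoc)
qed

lemma loc_lip_Lk: "loc_lip K f \<Longrightarrow> loc_lip ((real q * W * \<theta>) ^ k * K) ((L ^^ k) f)"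
proof (induction k)
  case (Suc k)
  then show ?case using loc_lip_L[OF Suc.IH] by (simp add: mult_ac)
qed simp

text \<open>Paths in different cylinders are at distance at least \<open>\<theta> ^ n\<close>, so
  for them twice the supremum bound divided by \<open>\<theta> ^ n\<close> is a Lipschitz
  constant.\<close>

lemma bnd_L_exists: "\<exists>C\<ge>0. \<forall>K f. bnd K f \<longrightarrow> bnd (C * K) (L f)"
proof -
  define C where "C = 2 * real q * W / \<theta> ^ n"
  have tn: "0 < \<theta> ^ n" "\<theta> ^ n \<le> 1" using theta by (auto simp: power_le_one)
  have qW: "0 \<le> real q * W" using pos by simp
  have C1: "real q * W \<le> C"
  proof -
    have "real q * W * \<theta> ^ n \<le> 2 * (real q * W)" using mult_left_mono[OF tn(2) qW] qW by linarith
    then show ?thesis using tn(1) by (simp add: C_def pos_le_divide_eq mult.assoc)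
  qed
  have "bnd (C * K) (L f)" if f: "bnd K f" for K f
  proof (rule bndI)
    have K: "0 \<le> K" using f by (rule bnd_nonneg)
    have sup: "cmod (L f p) \<le> real q * W * K" if "p \<in> P" for p
      using that K bnd_sup[OF f] by (rule L_sup)
    show "cmod (L f p) \<le> C * K" if "p \<in> P" for p
      using sup[OF that] mult_right_mono[OF C1 K] by linarith
    fix p p' assume p: "p \<in> P" "p' \<in> P"
    show "cmod (L f p - L f p') \<le> C * K * path_dist \<theta> p p'"
    proof (cases "agree p p'")
      case True
      have "cmod (L f p - L f p') \<le> (real q * W * K) * \<theta> * path_dist \<theta> p p'"
        using loc_lip_L[OF bnd_imp_loc_lip[OF f]] True p by (auto simp: loc_lip_def mult_ac)
      also have "\<dots> \<le> (C * K) * 1 * path_dist \<theta> p p'"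
        using C1 K qW theta by (intro mult_mono) auto
      finally show ?thesis by simp
    next
      case False
      have "cmod (L f p - L f p') \<le> 2 * (real q * W * K)"
        using norm_triangle_ineq4[of "L f p" "L f p'"] sup[OF p(1)] sup[OF p(2)] by linarith
      also have "\<dots> = C * K * \<theta> ^ n" using theta by (simp add: C_def)
      also have "\<dots> \<le> C * K * path_dist \<theta> p p'"
        using dist_not_agree[OF False] K C1 qW by (intro mult_left_mono) auto
      finally show ?thesis .
    qed
  qed (simp add: L_zero)
  then show ?thesis using C1 qW by (intro exI[of _ C]) auto
qed

section \<open>Projection onto cylinder functions\<close>

text \<open>A chosen path in each cylinder. The predicate depends on the first \<open>n\<close>
  edges only, so paths of one cylinder share their representative, and cylinder functions are
  characterised by equations between values.\<close>

definition rep :: "'v edge_seq \<Rightarrow> 'v edge_seq" where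
  "rep p = (SOME p'. p' \<in> P \<and> agree p' p)"

lemma rep: "p \<in> P \<Longrightarrow> rep p \<in> P \<and> agree (rep p) p"
  unfolding rep_def by (rule someI[of _ p]) (simp add: agree_def)

lemma rep_cong: "agree p p' \<Longrightarrow> rep p = rep p'"
  unfolding rep_def agree_def by (metis (no_types, lifting))

lemma rep_rep: "p \<in> P \<Longrightarrow> rep (rep p) = rep p"
  using rep rep_cong by blast

lemma finite_reps: "finite (rep ` P)"
proof -
  define g where "g l = (SOME p'. p' \<in> P \<and> (\<forall>i<n. p' i = l ! i))" for l
  have "rep p = g (map p [0..<n])" for p
    unfolding rep_def g_def agree_def by (intro arg_cong[of _ _ Eps] ext) auto
  moreover have "map p [0..<n] \<in> {l. set l \<subseteq> A \<and> length l = n}" if "p \<in> P" for p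
    using that by (auto simp: P_eq)
  ultimately have "rep ` P \<subseteq> g ` {l. set l \<subseteq> A \<and> length l = n}" by auto
  then show ?thesis using finite_lists_length_eq[OF finite_A] finite_subset by blast
qed

definition cyl :: "('v edge_seq \<Rightarrow> complex) \<Rightarrow> bool" where
  "cyl f \<longleftrightarrow> (\<forall>p. p \<notin> P \<longrightarrow> f p = 0) \<and> (\<forall>p\<in>P. f (rep p) = f p)"

definition E :: "'v operator" where
  "E f = (\<lambda>p. if p \<in> P then f (rep p) else 0)"

text \<open>The complementary projection models the quotient by the cylinder functions inside the
  function space itself.\<close>

definition Q :: "'v operator" where
  "Q f = (\<lambda>p. f p - E f p)"

lemma cyl_E: "cyl (E f)"
  by (auto simp: cyl_def E_def rep rep_rep)

lemma E_cyl: "cyl f \<Longrightarrow> E f = f"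
  by (auto simp: cyl_def E_def)

lemma E_lin: "E (\<lambda>p. a * f p + b * g p) = (\<lambda>p. a * E f p + b * E g p)"
  by (auto simp: E_def)

lemma Q_lin: "Q (\<lambda>p. a * f p + b * g p) = (\<lambda>p. a * Q f p + b * Q g p)"
  by (simp add: Q_def E_lin algebra_simps)

lemma cyl_lincomb: "cyl f \<Longrightarrow> cyl g \<Longrightarrow> cyl (\<lambda>p. a * f p + b * g p)"
  by (auto simp: cyl_def)

lemma cyl_sum: "(\<And>i. i \<in> S \<Longrightarrow> cyl (h i)) \<Longrightarrow> cyl (\<lambda>p. \<Sum>i\<in>S. a i * h i p)"
  by (auto simp: cyl_def intro!: sum.neutral sum.cong)

lemma cyl_L:
  assumes "cyl f" shows "cyl (L f)"
  unfolding cyl_def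
proof (intro conjI allI impI ballI)
  fix p assume p: "p \<in> P"
  have r: "rep p \<in> P" "agree (rep p) p" using rep[OF p] by auto
  have "\<omega> (case_nat a (rep p)) * f (case_nat a (rep p)) = \<omega> (case_nat a p) * f (case_nat a p)"
    if "a \<in> A" "step a (p 0)" for a
  proof -
    have m: "case_nat a (rep p) \<in> P" "case_nat a p \<in> P"
      using case_nat_mem p r that agree_0[OF r(2)] by auto
    have ag: "agree (case_nat a (rep p)) (case_nat a p)" using agree_case_nat[OF r(2)] .
    have "f (case_nat a (rep p)) = f (case_nat a p)"
      using assms m rep_cong[OF ag] unfolding cyl_def by metis
    moreover have "\<omega> (case_nat a (rep p)) = \<omega> (case_nat a p)"
      using ag by (intro weight_local m) (auto simp: agree_def)
    ultimately show ?thesis by simp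
  qed
  then show "L f (rep p) = L f p"
    unfolding L_eq[OF p] L_eq[OF r(1)] agree_0[OF r(2)] by (intro sum.cong) auto
qed (rule L_zero)

lemma cyl_Lk: "cyl f \<Longrightarrow> cyl ((L ^^ k) f)"
  by (induction k) (auto intro: cyl_L)

text \<open>\<open>Q f\<close> compares \<open>f\<close> with its value at the representative of the
  same cylinder, so oscillation within cylinders controls it completely. The small-scale constant,
  which does not see differences between cylinders, therefore bounds the full norm of
  \<open>Q f\<close>.\<close>

lemma bnd_Q:
  assumes "loc_lip K f" "\<And>p. p \<notin> P \<Longrightarrow> f p = 0"
  shows "bnd (2 * K) (Q f)"
proof (rule bndI)
  have K: "0 \<le> K" using assms by (simp add: loc_lip_def)
  have b: "cmod (Q f p) \<le> K * path_dist \<theta> p (rep p)" if "p \<in> P" for p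
    using assms rep[OF that] that by (auto simp: Q_def E_def loc_lip_def agree_def)
  \<comment> \<open>Agreement on \<open>n\<close> edges gives distance at most
    \<open>\<theta> ^ Suc n\<close>, while different cylinders are at least
    \<open>\<theta> ^ n\<close> apart; this settles the pairs that do not agree.\<close>
  have bt: "cmod (Q f p) \<le> K * \<theta> ^ Suc n" if "p \<in> P" for p
  proof -
    have "path_dist \<theta> p (rep p) \<le> \<theta> ^ Suc n"
      using rep[OF that] by (intro path_dist_le theta) (auto simp: agree_def)
    then show ?thesis using b[OF that] mult_left_mono[OF _ K] order_trans by blast
  qed
  have t: "\<theta> ^ Suc n \<le> \<theta> ^ n" "\<theta> ^ Suc n \<le> 1"
    using theta power_decreasing[of n "Suc n" \<theta>] power_le_one[of \<theta> "Suc n"] by auto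
  show "cmod (Q f p) \<le> 2 * K" if "p \<in> P" for p
    using bt[OF that] mult_left_mono[OF t(2) K] K by linarith
  fix p p' assume p: "p \<in> P" "p' \<in> P"
  show "cmod (Q f p - Q f p') \<le> 2 * K * path_dist \<theta> p p'"
  proof (cases "agree p p'")
    case True
    have "cmod (Q f p - Q f p') \<le> K * path_dist \<theta> p p'"
      using assms True p rep_cong[OF True] by (auto simp: Q_def E_def loc_lip_def)
    also have "\<dots> \<le> 2 * K * path_dist \<theta> p p'" using K by (intro mult_right_mono) auto
    finally show ?thesis .
  next
    case False
    have "cmod (Q f p - Q f p') \<le> 2 * K * \<theta> ^ Suc n"
      using norm_triangle_ineq4[of "Q f p" "Q f p'"] bt[OF p(1)] bt[OF p(2)] by linarith
    also have "\<dots> \<le> 2 * K * path_dist \<theta> p p'"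
      using dist_not_agree[OF False] t(1) K by (intro mult_left_mono) auto
    finally show ?thesis .
  qed
qed (use assms in \<open>simp add: Q_def E_def\<close>)

lemma bnd_E:
  assumes "bnd K f" shows "bnd (3 * K) (E f)"
proof -
  have "bnd (2 * K) (Q f)"
    using bnd_imp_loc_lip[OF assms] bnd_zero[OF assms] by (rule bnd_Q)
  from bnd_add[OF assms bnd_scale[OF this, of "-1"]] show ?thesis by (simp add: Q_def)
qed

lemma hol_at_E:
  assumes "hol_at s M" shows "hol_at s (\<lambda>w \<phi>. E (M w \<phi>))"
  using assms
proof (rule hol_at_compose[where C' = 3])
  fix g :: "complex \<Rightarrow> 'v edge_seq \<Rightarrow> complex" and U p
  assume "\<And>p. (\<lambda>w. g w p) holomorphic_on U"
  then show "(\<lambda>w. E (g w) p) holomorphic_on U" by (cases "p \<in> P") (simp_all add: E_def)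
qed (simp_all add: bnd_E E_lin)

lemma hol_at_L:
  assumes "hol_at s M" shows "hol_at s (\<lambda>w \<phi>. L (M w \<phi>))"
proof -
  obtain C where C: "0 \<le> C" "\<And>K f. bnd K f \<Longrightarrow> bnd (C * K) (L f)" using bnd_L_exists by blast
  show ?thesis
    using assms C(2,1) L_lin
  proof (rule hol_at_compose)
    fix g :: "complex \<Rightarrow> 'v edge_seq \<Rightarrow> complex" and U p
    assume "\<And>p. (\<lambda>w. g w p) holomorphic_on U"
    then show "(\<lambda>w. L (g w) p) holomorphic_on U"
      unfolding transfer_op_def by (intro holomorphic_intros)
  qed
qed

lemma hol_at_Lk: "hol_at s M \<Longrightarrow> hol_at s (\<lambda>w \<phi>. (L ^^ k) (M w \<phi>))"
  by (induction k) (simp_all add: hol_at_L)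

section \<open>The resolvent modulo cylinder functions\<close>

text \<open>
  Since \<open>L\<close> preserves cylinder functions, \<open>Q L E = 0\<close> and hence \<open>(Q L)\<^sup>k Q = Q L\<^sup>k\<close>; the series below
  is the Neumann series of the operator induced by \<open>L\<close> on the quotient by the cylinder functions.
\<close>

definition neumann :: "complex \<Rightarrow> 'v operator" where
  "neumann z \<phi> p = (\<Sum>k. z ^ k * Q ((L ^^ k) \<phi>) p)"

abbreviation rate :: real where "rate \<equiv> real q * W * \<theta>"

lemma rate_pos: "0 < rate"
  using pos theta by simp

lemma Q_L_Q: "Q (L (Q f)) = Q (L f)"
proof -
  have "Q f = (\<lambda>p. 1 * f p + (-1) * E f p)" by (simp add: Q_def)
  then have "Q (L (Q f)) = (\<lambda>p. 1 * Q (L f) p + (-1) * Q (L (E f)) p)"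
    by (simp only: L_lin Q_lin)
  moreover have "Q (L (E f)) = (\<lambda>_. 0)"
    using E_cyl[OF cyl_L[OF cyl_E[of f]]] by (simp add: Q_def)
  ultimately show ?thesis by simp
qed

lemma Lk_zero: "(\<And>p. p \<notin> P \<Longrightarrow> f p = 0) \<Longrightarrow> p \<notin> P \<Longrightarrow> (L ^^ k) f p = 0"
  by (cases k) (simp_all add: L_zero)

text \<open>Estimating \<open>Q\<close> once, after all of \<open>L ^^ k\<close>, keeps the factor 2
  of \<open>bnd_Q\<close> from being raised to the power \<open>k\<close>.\<close>

lemma bnd_Q_Lk:
  assumes "\<phi> \<in> F" shows "bnd (2 * (rate ^ k * nrm \<phi>)) (Q ((L ^^ k) \<phi>))"
proof (rule bnd_Q)
  show "loc_lip (rate ^ k * nrm \<phi>) ((L ^^ k) \<phi>)"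
    by (intro loc_lip_Lk bnd_imp_loc_lip bnd_nrm assms)
  show "(L ^^ k) \<phi> p = 0" if "p \<notin> P" for p
    using Lk_zero[of \<phi>, OF bnd_zero[OF bnd_nrm[OF assms]]] that by blast
qed

lemma geometric_suminf_bound:
  fixes a :: "nat \<Rightarrow> complex"
  assumes "\<And>k. cmod (a k) \<le> B * t ^ k" "0 \<le> t" "t < 1"
  shows "summable a" "cmod (suminf a) \<le> B / (1 - t)"
proof -
  have s: "(\<lambda>k. B * t ^ k) sums (B * (1 / (1 - t)))"
    using assms(2,3) by (intro sums_mult geometric_sums) simp
  show "summable a" using assms(1) sums_summable[OF s] by (rule summable_comparison_test'[rotated])
  have "cmod (suminf a) \<le> (\<Sum>k. B * t ^ k)"
    using assms(1) sums_summable[OF s] by (intro norm_suminf_le)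
  then show "cmod (suminf a) \<le> B / (1 - t)" using sums_unique[OF s] by simp
qed

lemma neumann_terms:
  assumes "\<phi> \<in> F" "cmod z * rate \<le> t"
  shows "cmod (z ^ k * Q ((L ^^ k) \<phi>) p) \<le> 2 * nrm \<phi> * t ^ k"
    and "p \<in> P \<Longrightarrow> p' \<in> P \<Longrightarrow>
      cmod (z ^ k * Q ((L ^^ k) \<phi>) p - z ^ k * Q ((L ^^ k) \<phi>) p') \<le> 2 * nrm \<phi> * path_dist \<theta> p p' * t ^ k"
proof -
  have tk: "cmod z ^ k * rate ^ k \<le> t ^ k"
    using assms(2) rate_pos by (simp flip: power_mult_distrib) (intro power_mono, auto)
  have n0: "0 \<le> nrm \<phi>" using assms(1) by (rule nrm_nonneg)
  have "cmod (z ^ k * Q ((L ^^ k) \<phi>) p) \<le> cmod z ^ k * (2 * (rate ^ k * nrm \<phi>))"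
    unfolding norm_mult norm_power by (intro mult_left_mono bnd_sup[OF bnd_Q_Lk[OF assms(1)]]) simp
  also have "\<dots> = 2 * nrm \<phi> * (cmod z ^ k * rate ^ k)" by (simp only: mult_ac)
  also have "\<dots> \<le> 2 * nrm \<phi> * t ^ k" using n0 tk by (intro mult_left_mono) auto
  finally show "cmod (z ^ k * Q ((L ^^ k) \<phi>) p) \<le> 2 * nrm \<phi> * t ^ k" .
  assume p: "p \<in> P" "p' \<in> P"
  have "cmod (z ^ k * Q ((L ^^ k) \<phi>) p - z ^ k * Q ((L ^^ k) \<phi>) p')
      \<le> cmod z ^ k * (2 * (rate ^ k * nrm \<phi>) * path_dist \<theta> p p')"
    unfolding norm_mult norm_power right_diff_distrib[symmetric]
    by (intro mult_left_mono bnd_lip[OF bnd_Q_Lk[OF assms(1)] p]) simp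
  also have "\<dots> = 2 * nrm \<phi> * path_dist \<theta> p p' * (cmod z ^ k * rate ^ k)" by (simp only: mult_ac)
  also have "\<dots> \<le> 2 * nrm \<phi> * path_dist \<theta> p p' * t ^ k" using n0 tk by (intro mult_left_mono) auto
  finally show "cmod (z ^ k * Q ((L ^^ k) \<phi>) p - z ^ k * Q ((L ^^ k) \<phi>) p')
      \<le> 2 * nrm \<phi> * path_dist \<theta> p p' * t ^ k" .
qed

lemma neumann_summable:
  assumes "\<phi> \<in> F" "cmod z * rate < 1"
  shows "summable (\<lambda>k. z ^ k * Q ((L ^^ k) \<phi>) p)"
  using neumann_terms(1)[OF assms(1) order_refl] assms(2) rate_pos
  by (intro geometric_suminf_bound(1)) auto

lemma neumann_sums:
  assumes "\<phi> \<in> F" "cmod z * rate < 1"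
  shows "(\<lambda>k. z ^ k * Q ((L ^^ k) \<phi>) p) sums neumann z \<phi> p"
  unfolding neumann_def using neumann_summable[OF assms] by (rule summable_sums)

text \<open>Values and differences are dominated by one geometric series, so the pointwise sum
  inherits both bounds. The ratio \<open>t\<close> is separate from \<open>z\<close> so that one
  constant can serve a whole neighbourhood.\<close>

lemma bop_neumann:
  assumes "cmod z * rate \<le> t" "t < 1"
  shows "bop (2 / (1 - t)) (neumann z)"
proof (rule bopI)
  have t0: "0 \<le> t" using assms(1) rate_pos by (meson less_imp_le mult_nonneg_nonneg norm_ge_zero order_trans)
  have z: "cmod z * rate < 1" using assms by simp
  show "0 \<le> 2 / (1 - t)" using assms by simp
  fix \<phi> assume \<phi>: "\<phi> \<in> F"
  note terms = neumann_terms[OF \<phi> assms(1)]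
  show "bnd (2 / (1 - t) * nrm \<phi>) (neumann z \<phi>)"
  proof (rule bndI)
    show "neumann z \<phi> p = 0" if "p \<notin> P" for p
      using bnd_zero[OF bnd_Q_Lk[OF \<phi>] that] by (simp add: neumann_def)
    show "cmod (neumann z \<phi> p) \<le> 2 / (1 - t) * nrm \<phi>" for p
      using geometric_suminf_bound(2)[OF terms(1)[where p = p] t0 assms(2)] by (simp add: neumann_def)
    show "cmod (neumann z \<phi> p - neumann z \<phi> p') \<le> 2 / (1 - t) * nrm \<phi> * path_dist \<theta> p p'"
      if "p \<in> P" "p' \<in> P" for p p'
      using geometric_suminf_bound(2)[OF terms(2)[OF that] t0 assms(2)]
      unfolding neumann_def suminf_diff[OF neumann_summable[OF \<phi> z] neumann_summable[OF \<phi> z]]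
      by simp
  qed
next
  fix \<phi> \<psi> a b p assume m: "\<phi> \<in> F" "\<psi> \<in> F"
  have z: "cmod z * rate < 1" using assms by simp
  have "(\<lambda>k. a * (z ^ k * Q ((L ^^ k) \<phi>) p) + b * (z ^ k * Q ((L ^^ k) \<psi>) p))
      sums (a * neumann z \<phi> p + b * neumann z \<psi> p)"
    by (intro sums_add sums_mult neumann_sums m z)
  moreover have "(\<lambda>k. z ^ k * Q ((L ^^ k) (\<lambda>p. a * \<phi> p + b * \<psi> p)) p)
      = (\<lambda>k. a * (z ^ k * Q ((L ^^ k) \<phi>) p) + b * (z ^ k * Q ((L ^^ k) \<psi>) p))"
    by (simp add: Lk_lin Q_lin algebra_simps)
  ultimately show "neumann z (\<lambda>p. a * \<phi> p + b * \<psi> p) p = a * neumann z \<phi> p + b * neumann z \<psi> p"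
    using sums_unique2[OF neumann_sums[OF F_lincomb[OF m, of a b] z, of p]] by simp
qed

lemma neumann_holomorphic:
  assumes "\<phi> \<in> F" shows "(\<lambda>z. neumann z \<phi> p) holomorphic_on ball 0 (1 / rate)"
proof (rule power_series_holomorphic[where a = "\<lambda>k. Q ((L ^^ k) \<phi>) p"])
  fix w :: complex assume "w \<in> ball 0 (1 / rate)"
  then have "cmod w * rate < 1" using rate_pos by (simp add: field_simps)
  from neumann_sums[OF assms this, of p]
  show "(\<lambda>k. Q ((L ^^ k) \<phi>) p * (w - 0) ^ k) sums neumann w \<phi> p" by (simp add: mult.commute)
qed

lemma L_sums:
  assumes "\<And>p. (\<lambda>k. h k p) sums f p" shows "(\<lambda>k. L (h k) p) sums L f p"
  unfolding transfer_op_def by (intro sums_sum sums_mult assms)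

lemma Q_sums:
  assumes "\<And>p. (\<lambda>k. h k p) sums f p" shows "(\<lambda>k. Q (h k) p) sums Q f p"
  unfolding Q_def E_def using assms by (cases "p \<in> P") (auto intro: sums_diff)

text \<open>By \<open>Q_L_Q\<close>, applying \<open>z * Q L\<close> shifts the series by one index,
  and only the term \<open>k = 0\<close>, which is \<open>Q \<phi>\<close>, is left over.\<close>

lemma neumann_eq:
  assumes "\<phi> \<in> F" "cmod z * rate < 1"
  shows "neumann z \<phi> p - z * Q (L (neumann z \<phi>)) p = Q \<phi> p"
proof -
  have "(\<lambda>k. Q (L (\<lambda>p. z ^ k * Q ((L ^^ k) \<phi>) p)) p) sums Q (L (neumann z \<phi>)) p"
    by (intro Q_sums L_sums neumann_sums assms)
  moreover have "Q (L (\<lambda>p. z ^ k * Q ((L ^^ k) \<phi>) p)) p = z ^ k * Q ((L ^^ Suc k) \<phi>) p" for k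
    using L_lin[of "z ^ k" "Q ((L ^^ k) \<phi>)" 0 "\<lambda>_. 0"] Q_lin[of "z ^ k" "L (Q ((L ^^ k) \<phi>))" 0 "\<lambda>_. 0"]
    by (simp add: Q_L_Q)
  ultimately have "(\<lambda>k. z ^ k * Q ((L ^^ Suc k) \<phi>) p) sums Q (L (neumann z \<phi>)) p" by simp
  then have "(\<lambda>k. z ^ Suc k * Q ((L ^^ Suc k) \<phi>) p) sums (z * Q (L (neumann z \<phi>)) p)"
    using sums_mult[of _ _ z] by (simp add: mult.assoc)
  then have "(\<lambda>k. z ^ k * Q ((L ^^ k) \<phi>) p) sums (z * Q (L (neumann z \<phi>)) p + Q \<phi> p)"
    by (subst (asm) sums_Suc_iff) simp
  then show ?thesis using sums_unique2[OF neumann_sums[OF assms]] by simp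
qed

section \<open>The resolvent on cylinder functions\<close>

text \<open>Gaussian elimination, one coordinate at a time: more vectors than coordinates are
  linearly dependent. Vectors are indexed, so repetitions count.\<close>

lemma ex_linear_relation:
  fixes v :: "'i \<Rightarrow> 'x \<Rightarrow> complex"
  assumes "finite X" "finite I" "card X < card I"
  shows "\<exists>c. (\<exists>i\<in>I. c i \<noteq> 0) \<and> (\<forall>x\<in>X. (\<Sum>i\<in>I. c i * v i x) = 0)"
  using assms
proof (induction X arbitrary: I v rule: finite_induct)
  case empty
  then have "I \<noteq> {}" by auto
  then show ?case by (intro exI[of _ "\<lambda>_. 1"]) auto
next
  case (insert x X)
  show ?case
  proof (cases "\<forall>i\<in>I. v i x = 0")
    case True
    obtain c where "\<exists>i\<in>I. c i \<noteq> 0" "\<forall>x\<in>X. (\<Sum>i\<in>I. c i * v i x) = 0"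
      using insert.IH[OF insert.prems(1), of v] insert.prems(2) insert.hyps by auto
    then show ?thesis using True by (intro exI[of _ c]) auto
  next
    case False
    then obtain k where k: "k \<in> I" "v k x \<noteq> 0" by blast
    \<comment> \<open>\<open>u\<close> clears the coordinate \<open>x\<close> with pivot
      \<open>k\<close>; the coefficient of \<open>k\<close> in \<open>c'\<close> collects the
      subtracted multiples.\<close>
    define u where "u i y = v i y - v i x / v k x * v k y" for i y
    have "card X < card (I - {k})" using insert.prems insert.hyps k by simp
    then obtain c where c: "\<exists>i\<in>I - {k}. c i \<noteq> 0" "\<forall>y\<in>X. (\<Sum>i\<in>I - {k}. c i * u i y) = 0"
      using insert.IH[of "I - {k}" u] insert.prems(1) by auto
    define c' where "c' = c(k := - (\<Sum>i\<in>I - {k}. c i * v i x / v k x))"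
    have "(\<Sum>i\<in>I. c' i * v i y) = (\<Sum>i\<in>I - {k}. c i * u i y)" for y
    proof -
      have "(\<Sum>i\<in>I. c' i * v i y) = c' k * v k y + (\<Sum>i\<in>I - {k}. c' i * v i y)"
        using insert.prems(1) k(1) by (rule sum.remove)
      also have "(\<Sum>i\<in>I - {k}. c' i * v i y) = (\<Sum>i\<in>I - {k}. c i * v i y)"
        by (rule sum.cong) (auto simp: c'_def)
      finally show ?thesis
        by (simp add: c'_def u_def right_diff_distrib sum_subtractf sum_distrib_right mult.assoc)
    qed
    moreover have "u i x = 0" for i using k by (simp add: u_def)
    ultimately have "\<forall>y\<in>insert x X. (\<Sum>i\<in>I. c' i * v i y) = 0" using c(2) by simp
    moreover have "\<exists>i\<in>I. c' i \<noteq> 0" using c(1) by (auto simp: c'_def)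
    ultimately show ?thesis by blast
  qed
qed

definition cyl_ind :: "'v edge_seq \<Rightarrow> 'v edge_seq \<Rightarrow> complex" where
  "cyl_ind w p = of_bool (p \<in> P \<and> rep p = w)"

lemma cyl_expand:
  assumes "cyl f" shows "f p = (\<Sum>w\<in>rep ` P. f w * cyl_ind w p)"
proof (cases "p \<in> P")
  case True
  have "(\<Sum>w\<in>rep ` P. f w * cyl_ind w p) = (\<Sum>w\<in>rep ` P. if w = rep p then f w else 0)"
    using True by (intro sum.cong) (auto simp: cyl_ind_def)
  also have "\<dots> = f p" using True finite_reps assms by (simp add: cyl_def)
  finally show ?thesis by simp
qed (use assms in \<open>simp add: cyl_def cyl_ind_def\<close>)

text \<open>The top coefficient must not vanish because it becomes the value of
  \<open>rev_poly\<close> at 0, which keeps that denominator from being identically zero.\<close>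

definition annihilates :: "nat \<Rightarrow> (nat \<Rightarrow> complex) \<Rightarrow> bool" where
  "annihilates K c \<longleftrightarrow> c K \<noteq> 0 \<and> (\<forall>g. cyl g \<longrightarrow> (\<forall>p. (\<Sum>i\<le>K. c i * (L ^^ i) g p) = 0))"

text \<open>On cylinder functions the powers of \<open>L\<close> are matrices over the
  representatives, with \<open>card X\<close> entries; so the \<open>card X + 1\<close> powers from
  0 to \<open>card X\<close> are dependent. \<open>K\<close> is the last index with a nonzero
  coefficient.\<close>

lemma ex_annihilator: "\<exists>K c. annihilates K c"
proof -
  let ?R = "rep ` P"
  define X where "X = ?R \<times> ?R"
  define v where "v i x = (L ^^ i) (cyl_ind (snd x)) (fst x)" for i x
  have "finite X" using finite_reps by (simp add: X_def)
  then obtain c where c: "\<exists>i\<in>{..card X}. c i \<noteq> 0"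
    "\<And>x. x \<in> X \<Longrightarrow> (\<Sum>i\<in>{..card X}. c i * v i x) = 0"
    using ex_linear_relation[of X "{..card X}" v] by auto
  define K where "K = Max {i. i \<le> card X \<and> c i \<noteq> 0}"
  have fin: "finite {i. i \<le> card X \<and> c i \<noteq> 0}" by simp
  have "{i. i \<le> card X \<and> c i \<noteq> 0} \<noteq> {}" using c(1) by auto
  from Max_in[OF fin this] have K: "K \<le> card X" "c K \<noteq> 0" by (simp_all add: K_def)
  have top: "c i = 0" if "i \<le> card X" "K < i" for i
  proof (rule ccontr)
    assume "c i \<noteq> 0"
    then have "i \<le> K" unfolding K_def using that(1) by (intro Max_ge fin) simp
    then show False using that(2) by simp
  qed
  have "(\<Sum>i\<le>K. c i * (L ^^ i) g p) = 0" if g: "cyl g" for g p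
  proof (cases "p \<in> P")
    case True
    have "(\<Sum>i\<le>K. c i * (L ^^ i) g p) = (\<Sum>i\<le>card X. c i * (L ^^ i) g p)"
      using K(1) top by (intro sum.mono_neutral_left) auto
    also have "\<dots> = (\<Sum>i\<le>card X. \<Sum>w\<in>?R. g w * (c i * v i (rep p, w)))"
    proof (rule sum.cong)
      fix i
      have "(L ^^ i) g p = (L ^^ i) g (rep p)" using cyl_Lk[OF g] True by (simp add: cyl_def)
      also have "\<dots> = (L ^^ i) (\<lambda>p. \<Sum>w\<in>?R. g w * cyl_ind w p) (rep p)"
        using cyl_expand[OF g] by (intro arg_cong[where f = "\<lambda>h. (L ^^ i) h (rep p)"] ext)
      also have "(L ^^ i) (\<lambda>p. \<Sum>w\<in>?R. g w * cyl_ind w p) (rep p) = (\<Sum>w\<in>?R. g w * v i (rep p, w))"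
        using finite_reps by (simp add: Lk_sum v_def)
      finally have "(L ^^ i) g p = (\<Sum>w\<in>?R. g w * v i (rep p, w))" .
      then show "c i * (L ^^ i) g p = (\<Sum>w\<in>?R. g w * (c i * v i (rep p, w)))"
        by (simp add: sum_distrib_left mult_ac)
    qed simp
    also have "\<dots> = (\<Sum>w\<in>?R. \<Sum>i\<le>card X. g w * (c i * v i (rep p, w)))" by (rule sum.swap)
    also have "\<dots> = (\<Sum>w\<in>?R. g w * (\<Sum>i\<le>card X. c i * v i (rep p, w)))"
      by (simp add: sum_distrib_left)
    also have "\<dots> = 0" using c(2) True by (intro sum.neutral) (auto simp: X_def)
    finally show ?thesis .
  next
    case False
    then show ?thesis using cyl_Lk[OF g] by (simp add: cyl_def)
  qed
  then show ?thesis using K(2) by (auto simp: annihilates_def)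
qed

text \<open>
  If \<open>\<Sum>i\<le>K. c i * L ^ i\<close> annihilates the cylinder functions, summing the geometric sums
  \<open>(1 - z L) * (\<Sum>j<i. (z L) ^ j) = 1 - (z L) ^ i\<close> inverts \<open>1 - z L\<close> on them up to the scalar
  \<open>rev_poly c K z\<close>.
\<close>

definition rev_poly :: "(nat \<Rightarrow> complex) \<Rightarrow> nat \<Rightarrow> complex \<Rightarrow> complex" where
  "rev_poly c K z = (\<Sum>i\<le>K. c i * z ^ (K - i))"

definition adj_op :: "(nat \<Rightarrow> complex) \<Rightarrow> nat \<Rightarrow> complex \<Rightarrow> 'v operator" where
  "adj_op c K z y p = (\<Sum>i\<le>K. c i * z ^ (K - i) * (\<Sum>j<i. z ^ j * (L ^^ j) y p))"

lemma cyl_adj_op: "cyl y \<Longrightarrow> cyl (adj_op c K z y)"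
  unfolding adj_op_def by (intro cyl_sum cyl_Lk)

lemma L_sum:
  assumes "finite S" shows "L (\<lambda>p. \<Sum>i\<in>S. a i * h i p) = (\<lambda>p. \<Sum>i\<in>S. a i * L (h i) p)"
  using Lk_sum[OF assms, of 1] by simp

lemma adj_op_eq:
  assumes "annihilates K c" "cyl y"
  shows "adj_op c K z y p - z * L (adj_op c K z y) p = rev_poly c K z * y p"
proof -
  have tele: "(\<Sum>j<i. z ^ j * (L ^^ j) y p) - z * (\<Sum>j<i. z ^ j * L ((L ^^ j) y) p)
      = y p - z ^ i * (L ^^ i) y p" for i
    by (induction i) (auto simp: algebra_simps)
  have "L (adj_op c K z y) p = (\<Sum>i\<le>K. c i * z ^ (K - i) * (\<Sum>j<i. z ^ j * L ((L ^^ j) y) p))"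
    unfolding adj_op_def by (simp add: L_sum)
  then have "adj_op c K z y p - z * L (adj_op c K z y) p
      = (\<Sum>i\<le>K. c i * z ^ (K - i) * ((\<Sum>j<i. z ^ j * (L ^^ j) y p) - z * (\<Sum>j<i. z ^ j * L ((L ^^ j) y) p)))"
    by (simp add: adj_op_def sum_distrib_left right_diff_distrib sum_subtractf mult_ac)
  also have "\<dots> = (\<Sum>i\<le>K. c i * z ^ (K - i) * y p - z ^ K * (c i * (L ^^ i) y p))"
    unfolding tele
  proof (rule sum.cong)
    fix i assume "i \<in> {..K}"
    then have "z ^ K = z ^ (K - i) * z ^ i" by (simp flip: power_add)
    then show "c i * z ^ (K - i) * (y p - z ^ i * (L ^^ i) y p)
        = c i * z ^ (K - i) * y p - z ^ K * (c i * (L ^^ i) y p)" by (simp add: algebra_simps)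
  qed simp
  also have "\<dots> = rev_poly c K z * y p - z ^ K * (\<Sum>i\<le>K. c i * (L ^^ i) y p)"
    by (simp add: sum_subtractf rev_poly_def sum_distrib_left sum_distrib_right)
  also have "\<dots> = rev_poly c K z * y p" using assms by (simp add: annihilates_def)
  finally show ?thesis .
qed

section \<open>Meromorphic continuation in the multiplier\<close>

text \<open>For \<open>N = neumann z \<phi>\<close> the defect \<open>\<phi> - (1 - z L) N\<close>
  equals \<open>E \<phi> + z E L N\<close> by \<open>neumann_eq\<close>; \<open>adj_op\<close> then
  inverts \<open>1 - z L\<close> on this cylinder function up to the denominator.\<close>

definition finite_part :: "(nat \<Rightarrow> complex) \<Rightarrow> nat \<Rightarrow> complex \<Rightarrow> 'v operator" where
  "finite_part c K z \<phi> = adj_op c K z (\<lambda>p. E \<phi> p + z * E (L (neumann z \<phi>)) p)"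

definition resolvent :: "(nat \<Rightarrow> complex) \<Rightarrow> nat \<Rightarrow> complex \<Rightarrow> 'v operator" where
  "resolvent c K z \<phi> p = neumann z \<phi> p + finite_part c K z \<phi> p / rev_poly c K z"

lemma cyl_finite_part: "cyl (finite_part c K z \<phi>)"
proof -
  have "cyl (\<lambda>p. E \<phi> p + z * E (L (neumann z \<phi>)) p)"
    using cyl_lincomb[OF cyl_E cyl_E, of 1 \<phi> z] by simp
  then show ?thesis unfolding finite_part_def by (rule cyl_adj_op)
qed

lemma resolvent_right_inverse:
  assumes "annihilates K c" "\<phi> \<in> F" "cmod z * rate < 1" "rev_poly c K z \<noteq> 0"
  shows "resolvent c K z \<phi> p - z * L (resolvent c K z \<phi>) p = \<phi> p"
proof -
  let ?N = "neumann z \<phi>" and ?B = "finite_part c K z \<phi>" and ?r = "rev_poly c K z"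
  have "cyl (\<lambda>p. E \<phi> p + z * E (L ?N) p)"
    using cyl_lincomb[OF cyl_E cyl_E, of 1 \<phi> z] by simp
  from adj_op_eq[OF assms(1) this]
  have B: "?B p - z * L ?B p = ?r * (E \<phi> p + z * E (L ?N) p)" by (simp add: finite_part_def)
  have "resolvent c K z \<phi> = (\<lambda>p. 1 * ?N p + (1 / ?r) * ?B p)"
    by (simp add: resolvent_def fun_eq_iff)
  then have "L (resolvent c K z \<phi>) p = L ?N p + L ?B p / ?r" by (simp only: L_lin) simp
  then have "resolvent c K z \<phi> p - z * L (resolvent c K z \<phi>) p
      = ?N p - z * L ?N p + (?B p - z * L ?B p) / ?r"
    by (simp add: resolvent_def diff_divide_distrib algebra_simps)
  also have "\<dots> = ?N p - z * L ?N p + (E \<phi> p + z * E (L ?N) p)" using assms(4) B by simp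
  also have "\<dots> = ?N p - z * Q (L ?N) p + E \<phi> p" by (simp add: Q_def algebra_simps)
  also have "\<dots> = \<phi> p" using neumann_eq[OF assms(2,3), of p] by (simp add: Q_def)
  finally show ?thesis .
qed

text \<open>In the supremum norm \<open>L\<close> is bounded by \<open>q * W\<close>, so a solution
  is no larger than a proper fraction of itself. This will turn a right inverse into a two-sided
  one.\<close>

lemma one_minus_L_injective:
  assumes f: "f \<in> F" and z: "cmod z * (real q * W) < 1" and eq: "\<And>p. f p = z * L f p"
  shows "f p = 0"
proof -
  define S where "S = (SUP p\<in>P. cmod (f p))"
  have "bdd_above ((\<lambda>p. cmod (f p)) ` P)"
    using bnd_sup[OF bnd_nrm[OF f]] by (intro bdd_aboveI[of _ "nrm f"]) auto
  then have S: "cmod (f p) \<le> S" if "p \<in> P" for p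
    unfolding S_def using that by (intro cSUP_upper)
  have S0: "0 \<le> S" using S nonempty norm_ge_zero order_trans by blast
  have "cmod (f p) \<le> cmod z * (real q * W) * S" if "p \<in> P" for p
    using L_sup[OF that S0 S] eq[of p] by (simp add: norm_mult mult_left_mono mult.assoc)
  then have "S \<le> cmod z * (real q * W) * S" unfolding S_def using nonempty by (intro cSUP_least)
  moreover have "cmod z * (real q * W) * S < 1 * S" if "S \<noteq> 0"
    using z S0 that by (intro mult_strict_right_mono) auto
  ultimately have "S = 0" by fastforce
  then show ?thesis using S[of p] bnd_zero[OF bnd_nrm[OF f], of p] by (cases "p \<in> P") auto
qed

lemma cyl_ind_in_lip_space: "cyl_ind w \<in> F"
proof -
  have t: "0 < \<theta> ^ n" "\<theta> ^ n \<le> 1" using theta by (auto simp: power_le_one)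
  have "bnd (1 / \<theta> ^ n) (cyl_ind w)"
  proof (rule bndI)
    have "1 \<le> 1 / \<theta> ^ n" using t by simp
    then show "cmod (cyl_ind w p) \<le> 1 / \<theta> ^ n" for p
      using order_trans[of "cmod (cyl_ind w p)" 1] t by (simp add: cyl_ind_def)
    show "cmod (cyl_ind w p - cyl_ind w p') \<le> 1 / \<theta> ^ n * path_dist \<theta> p p'"
      if "p \<in> P" "p' \<in> P" for p p'
    proof (cases "agree p p'")
      case True
      then show ?thesis using rep_cong[OF True] that t by (simp add: cyl_ind_def)
    next
      case False
      have "cmod (cyl_ind w p - cyl_ind w p') \<le> 1" by (auto simp: cyl_ind_def)
      also have "1 \<le> 1 / \<theta> ^ n * path_dist \<theta> p p'"
        using dist_not_agree[OF False] t by (simp add: pos_le_divide_eq)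
      finally show ?thesis .
    qed
  qed (simp add: cyl_ind_def)
  then show ?thesis using lip_space_iff_bnd by blast
qed

lemma finite_rank_cyl:
  assumes "\<And>\<phi>. \<phi> \<in> F \<Longrightarrow> cyl (T \<phi>)" shows "finite_rank \<theta> P T"
proof -
  let ?R = "rep ` P"
  \<comment> \<open>\<open>finite_rank\<close> sums over a set of functions, so coefficients indexed
    by representatives must be transported along an injection.\<close>
  have inj: "inj_on cyl_ind ?R"
  proof (rule inj_onI)
    fix w w' assume w: "w \<in> ?R" "w' \<in> ?R" and eq: "cyl_ind w = cyl_ind w'"
    have "w \<in> P" "rep w = w" using w(1) rep rep_rep by auto
    then have "cyl_ind w w = 1" by (simp add: cyl_ind_def)
    then have "cyl_ind w' w = 1" using eq by simp
    then show "w = w'" using \<open>rep w = w\<close> by (simp add: cyl_ind_def split: if_splits)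
  qed
  have "\<exists>c. T \<phi> = (\<lambda>p. \<Sum>b\<in>cyl_ind ` ?R. c b * b p)" if "\<phi> \<in> F" for \<phi>
  proof (intro exI ext)
    fix p
    have eq: "(\<Sum>b\<in>cyl_ind ` ?R. T \<phi> (inv_into ?R cyl_ind b) * b p) = (\<Sum>w\<in>?R. T \<phi> w * cyl_ind w p)"
      using inj by (simp add: sum.reindex inv_into_f_f)
    show "T \<phi> p = (\<Sum>b\<in>cyl_ind ` ?R. T \<phi> (inv_into ?R cyl_ind b) * b p)"
      unfolding eq by (rule cyl_expand[OF assms[OF that]])
  qed
  then show ?thesis
    unfolding finite_rank_def using finite_reps cyl_ind_in_lip_space
    by (intro exI[of _ "cyl_ind ` ?R"]) auto
qed

section \<open>Meromorphic continuation in the spectral parameter\<close>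

definition zeta :: "complex \<Rightarrow> complex" where
  "zeta s = of_nat q powr (1 / 2 + \<i> * s)"

lemma zeta_eq: "zeta s = exp ((1 / 2 + \<i> * s) * of_real (ln (real q)))"
  using pos(1) by (simp add: zeta_def powr_def Ln_of_nat)

lemma cmod_zeta: "cmod (zeta s) = exp ((1 / 2 - Im s) * ln (real q))"
  by (simp add: zeta_eq)

lemma zeta_holomorphic: "zeta holomorphic_on U"
  unfolding zeta_eq[abs_def] by (intro holomorphic_intros)

text \<open>The modulus of \<open>zeta s\<close> is \<open>q powr (1/2 - Im s)\<close>; the further
  factor \<open>q\<close> in \<open>rate\<close> moves the threshold from 1/2 to 3/2.\<close>

lemma half_plane_iff:
  assumes "1 < q" "sup_norm P \<omega> = W"
  shows "s \<in> half_plane q \<theta> P \<omega> \<longleftrightarrow> cmod (zeta s) * rate < 1"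
proof -
  have lq: "0 < ln (real q)" using assms(1) by simp
  have "rate = exp (ln (real q) + ln (\<theta> * W))"
    using pos theta by (simp add: exp_add mult_ac)
  then have "cmod (zeta s) * rate = exp ((3 / 2 - Im s) * ln (real q) + ln (\<theta> * W))"
    unfolding cmod_zeta by (simp add: algebra_simps flip: exp_add)
  then have "cmod (zeta s) * rate < 1 \<longleftrightarrow> (3 / 2 - Im s) * ln (real q) + ln (\<theta> * W) < 0"
    by (simp only: exp_less_one_iff)
  also have "\<dots> \<longleftrightarrow> Im s > 3 / 2 + ln (\<theta> * W) / ln (real q)"
    using lq by (simp add: field_simps)
  finally show ?thesis unfolding half_plane_def assms(2) mem_Collect_eq by (rule sym)
qed

lemma hol_at_neumann:
  assumes "cmod (zeta s) * rate < 1" shows "hol_at s (\<lambda>w. neumann (zeta w))"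
proof -
  \<comment> \<open>A ratio strictly in between still dominates on a whole ball around
    \<open>s\<close>, which yields one operator bound there.\<close>
  obtain t where t: "cmod (zeta s) * rate < t \<and> t < 1" using dense[OF assms] by blast
  have "continuous_on UNIV (\<lambda>w. cmod (zeta w) * rate)"
    by (intro continuous_intros holomorphic_on_imp_continuous_on zeta_holomorphic)
  then have "open {w. cmod (zeta w) * rate < t}"
    by (intro open_Collect_less) (auto intro: continuous_intros)
  then obtain r where r: "0 < r" "ball s r \<subseteq> {w. cmod (zeta w) * rate < t}"
    using t open_contains_ball by blast
  have "fam s r (2 / (1 - t)) (\<lambda>w. neumann (zeta w))"
    unfolding fam_def
  proof (intro conjI ballI allI)
    show "bop (2 / (1 - t)) (neumann (zeta w))" if "w \<in> ball s r" for w
      using that r(2) t by (intro bop_neumann) auto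
    fix \<phi> p assume \<phi>: "\<phi> \<in> F"
    have "zeta ` ball s r \<subseteq> ball 0 (1 / rate)"
    proof
      fix z assume "z \<in> zeta ` ball s r"
      then have "cmod z * rate < 1" using r(2) t by force
      then show "z \<in> ball 0 (1 / rate)" using rate_pos by (simp add: pos_less_divide_eq mult_ac)
    qed
    then have "((\<lambda>z. neumann z \<phi> p) \<circ> zeta) holomorphic_on ball s r"
      by (rule holomorphic_on_compose_gen[OF zeta_holomorphic neumann_holomorphic[OF \<phi>]])
    then show "(\<lambda>w. neumann (zeta w) \<phi> p) holomorphic_on ball s r" by (simp add: o_def)
  qed (fact r(1))
  then show ?thesis by (auto simp: hol_at_def)
qed

lemma hol_at_finite_part:
  assumes "cmod (zeta s) * rate < 1" shows "hol_at s (\<lambda>w. finite_part c K (zeta w))"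
proof -
  define Y where "Y w \<phi> p = E \<phi> p + zeta w * E (L (neumann (zeta w) \<phi>)) p" for w \<phi> p
  have "hol_at s (\<lambda>w \<phi>. E \<phi>)" by (rule hol_at_E[OF hol_at_const[OF bop_id]])
  moreover have "hol_at s (\<lambda>w \<phi> p. zeta w * E (L (neumann (zeta w) \<phi>)) p)"
    by (rule hol_at_scale[OF hol_at_E[OF hol_at_L[OF hol_at_neumann[OF assms]]]
          zeta_holomorphic open_UNIV UNIV_I])
  ultimately have "hol_at s (\<lambda>w \<phi> p. E \<phi> p + zeta w * E (L (neumann (zeta w) \<phi>)) p)"
    by (rule hol_at_add)
  then have Y: "hol_at s Y" by (simp add: Y_def[abs_def])
  have summand: "hol_at s (\<lambda>w \<phi> p. (zeta w) ^ j * (L ^^ j) (Y w \<phi>) p)" for j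
    by (rule hol_at_scale[OF hol_at_Lk[OF Y] _ open_UNIV UNIV_I])
      (intro holomorphic_intros zeta_holomorphic)
  have inner: "hol_at s (\<lambda>w \<phi> p. \<Sum>j<i. (zeta w) ^ j * (L ^^ j) (Y w \<phi>) p)" for i
    by (rule hol_at_sum[OF _ summand]) simp
  have outer: "hol_at s (\<lambda>w \<phi> p. c i * (zeta w) ^ (K - i) * (\<Sum>j<i. (zeta w) ^ j * (L ^^ j) (Y w \<phi>) p))"
    for i
    by (rule hol_at_scale[OF inner _ open_UNIV UNIV_I])
      (intro holomorphic_intros zeta_holomorphic)
  have "hol_at s (\<lambda>w \<phi> p. \<Sum>i\<in>{..K}. c i * (zeta w) ^ (K - i) * (\<Sum>j<i. (zeta w) ^ j * (L ^^ j) (Y w \<phi>) p))"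
    by (rule hol_at_sum[OF _ outer]) simp
  moreover have "Y w \<phi> = (\<lambda>p. E \<phi> p + zeta w * E (L (neumann (zeta w) \<phi>)) p)" for w \<phi>
    by (simp add: Y_def[abs_def])
  ultimately show ?thesis by (simp add: finite_part_def[abs_def] adj_op_def[abs_def])
qed

lemma rev_poly_zeta_holomorphic: "(\<lambda>s. rev_poly c K (zeta s)) holomorphic_on U"
  unfolding rev_poly_def by (intro holomorphic_intros zeta_holomorphic)

lemma open_rev_poly_nonzero: "open {s. rev_poly c K (zeta s) \<noteq> 0}"
  by (intro open_Collect_neq holomorphic_on_imp_continuous_on rev_poly_zeta_holomorphic)
    (auto intro: continuous_intros)

lemma hol_at_resolvent:
  assumes "cmod (zeta s) * rate < 1" "rev_poly c K (zeta s) \<noteq> 0"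
  shows "hol_at s (\<lambda>w. resolvent c K (zeta w))"
proof -
  have "hol_at s (\<lambda>w \<phi> p. (1 / rev_poly c K (zeta w)) * finite_part c K (zeta w) \<phi> p)"
    using assms open_rev_poly_nonzero
    by (intro hol_at_scale[where U = "{s. rev_poly c K (zeta s) \<noteq> 0}"] hol_at_finite_part
        holomorphic_intros rev_poly_zeta_holomorphic) auto
  from hol_at_add[OF hol_at_neumann[OF assms(1)] this]
  show ?thesis by (simp add: resolvent_def[abs_def])
qed

section \<open>Zeros of the denominator and poles of the resolvent\<close>

lemma cmod_zeta_small:
  assumes "1 < q" "0 < \<epsilon>" "1 / 2 - ln \<epsilon> / ln (real q) < Im s"
  shows "cmod (zeta s) < \<epsilon>"
proof -
  have "(1 / 2 - Im s) * ln (real q) < ln \<epsilon>"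
    using assms(1,3) by (simp add: field_simps)
  then have "exp ((1 / 2 - Im s) * ln (real q)) < exp (ln \<epsilon>)" by (simp only: exp_less_cancel_iff)
  then show ?thesis using assms(2) by (simp add: cmod_zeta)
qed

lemma rev_poly_nonzero_near_0:
  assumes "c K \<noteq> 0"
  obtains \<delta> where "0 < \<delta>" "\<And>z. cmod z < \<delta> \<Longrightarrow> rev_poly c K z \<noteq> 0"
proof -
  have "rev_poly c K 0 = (\<Sum>i\<le>K. if i = K then c i else 0)"
    unfolding rev_poly_def by (rule sum.cong) (auto simp: power_0_left)
  then have "rev_poly c K 0 \<noteq> 0" using assms by simp
  moreover have "isCont (rev_poly c K) 0" unfolding rev_poly_def[abs_def] by (intro continuous_intros)
  ultimately obtain \<delta> where "0 < \<delta>" "\<forall>z. dist 0 z < \<delta> \<longrightarrow> rev_poly c K z \<noteq> 0"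
    using continuous_at_avoid by blast
  then show ?thesis using that by (simp add: dist_norm)
qed

lemma rev_poly_zero_factor:
  assumes "1 < q" "c K \<noteq> 0" "rev_poly c K (zeta s) = 0"
  shows "\<exists>g r N. 0 < r \<and> g holomorphic_on ball s r \<and>
    (\<forall>w\<in>ball s r. rev_poly c K (zeta w) = (w - s) ^ N * g w \<and> g w \<noteq> 0)"
proof -
  obtain \<delta> where \<delta>: "0 < \<delta>" "\<And>z. cmod z < \<delta> \<Longrightarrow> rev_poly c K z \<noteq> 0"
    using rev_poly_nonzero_near_0[of c K] assms(2) by blast
  \<comment> \<open>A point one unit above the height where \<open>cmod (zeta s)\<close> falls below
    \<open>\<delta>\<close>; the denominator is nonzero there and zero at \<open>s\<close>, hence
    not constant.\<close>
  define u where "u = \<i> * of_real (1 / 2 - ln \<delta> / ln (real q) + 1)"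
  have "1 / 2 - ln \<delta> / ln (real q) < Im u" by (simp add: u_def)
  then have "cmod (zeta u) < \<delta>" by (rule cmod_zeta_small[OF assms(1) \<delta>(1)])
  then have "rev_poly c K (zeta u) \<noteq> 0" using \<delta>(2) by blast
  then have nc: "\<not> (\<lambda>w. rev_poly c K (zeta w)) constant_on UNIV"
    using assms(3) unfolding constant_on_def by (metis UNIV_I)
  show ?thesis
  proof (rule holomorphic_factor_zero_nonconstant[OF rev_poly_zeta_holomorphic open_UNIV
        connected_UNIV UNIV_I assms(3) nc])
    fix g r N
    assume "0 < r" "g holomorphic_on ball s r"
      "\<And>w. w \<in> ball s r \<Longrightarrow> rev_poly c K (zeta w) = (w - s) ^ N * g w"
      "\<And>w. w \<in> ball s r \<Longrightarrow> g w \<noteq> 0"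
    then show ?thesis by (intro exI[of _ g] exI[of _ r] exI[of _ N]) simp
  qed
qed

lemma rev_poly_zeros_isolated:
  assumes "1 < q" "c K \<noteq> 0"
  shows "\<exists>e>0. \<forall>w\<in>ball s e - {s}. rev_poly c K (zeta w) \<noteq> 0"
proof (cases "rev_poly c K (zeta s) = 0")
  case True
  obtain g r N where "0 < r" "\<forall>w\<in>ball s r. rev_poly c K (zeta w) = (w - s) ^ N * g w \<and> g w \<noteq> 0"
    using rev_poly_zero_factor[where c = c and K = K, OF assms True] by (elim exE conjE)
  then show ?thesis by (intro exI[of _ r]) auto
next
  case False
  then obtain e where "0 < e" "ball s e \<subseteq> {s. rev_poly c K (zeta s) \<noteq> 0}"
    using open_rev_poly_nonzero[of c K] open_contains_ball by blast
  then show ?thesis by (intro exI[of _ e]) auto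
qed

text \<open>Separates zeros of the denominator that the numerator cancels from genuine poles;
  \<open>H\<close> is the holomorphic replacement near \<open>s\<close>.\<close>

definition removable :: "(nat \<Rightarrow> complex) \<Rightarrow> nat \<Rightarrow> complex \<Rightarrow> (complex \<Rightarrow> 'v operator) \<Rightarrow> bool" where
  "removable c K s H \<longleftrightarrow> hol_at s H \<and>
     (\<exists>r>0. \<forall>w\<in>ball s r - {s}. \<forall>\<phi>\<in>F. resolvent c K (zeta w) \<phi> = H w \<phi>)"

text \<open>Only \<open>finite_part\<close> is divided by the denominator, so after absorbing the
  nonvanishing cofactor \<open>g\<close> its Laurent expansion supplies all singular terms, with
  values in cylinder functions.\<close>

lemma resolvent_pole:
  assumes "1 < q" "c K \<noteq> 0" "cmod (zeta s) * rate < 1" "rev_poly c K (zeta s) = 0"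
    and not_removable: "\<And>H. \<not> removable c K s H"
  shows "\<exists>N B H r. 1 \<le> N \<and> (\<forall>j\<in>{1..N}. (\<exists>C. bop C (B j)) \<and> (\<forall>\<psi>\<in>F. cyl (B j \<psi>))) \<and>
    (\<exists>\<phi>\<in>F. B N \<phi> \<noteq> (\<lambda>_. 0)) \<and> hol_at s H \<and> 0 < r \<and>
    (\<forall>w\<in>ball s r - {s}. \<forall>\<psi>\<in>F.
      resolvent c K (zeta w) \<psi> = (\<lambda>p. (\<Sum>j=1..N. B j \<psi> p / (w - s) ^ j) + H w \<psi> p))"
proof -
  obtain g r M where g: "0 < r" "g holomorphic_on ball s r"
    "\<forall>w\<in>ball s r. rev_poly c K (zeta w) = (w - s) ^ M * g w \<and> g w \<noteq> 0"
    using rev_poly_zero_factor[where c = c and K = K, OF assms(1,2,4)] by (elim exE conjE)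
  define G where "G w \<phi> p = 1 / g w * finite_part c K (zeta w) \<phi> p" for w \<phi> p
  have "hol_at s (\<lambda>w \<phi> p. 1 / g w * finite_part c K (zeta w) \<phi> p)"
    using g by (intro hol_at_scale[where U = "ball s r"] hol_at_finite_part assms(3) holomorphic_intros) auto
  then have "hol_at s G" by (simp add: G_def[abs_def])
  moreover have "\<forall>w \<phi>. \<forall>p\<in>P. G w \<phi> (rep p) = G w \<phi> p"
    using cyl_finite_part by (simp add: G_def cyl_def)
  ultimately obtain B H where "laurent_at rep s M G B H" using laurent_expansion by blast
  then have B: "\<And>j. j \<in> {1..M} \<Longrightarrow> \<exists>C. bop C (B j)"
      "\<And>j \<phi> p. j \<in> {1..M} \<Longrightarrow> p \<in> P \<Longrightarrow> B j \<phi> (rep p) = B j \<phi> p"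
    and H: "hol_at s H"
    and eq: "\<And>w \<phi> p. w \<noteq> s \<Longrightarrow>
      G w \<phi> p / (w - s) ^ M = (\<Sum>j=1..M. B j \<phi> p / (w - s) ^ j) + H w \<phi> p"
    unfolding laurent_at_def by auto
  define H' where "H' w \<phi> p = neumann (zeta w) \<phi> p + H w \<phi> p" for w \<phi> p
  have H': "hol_at s H'"
    using hol_at_add[OF hol_at_neumann[OF assms(3)] H] by (simp add: H'_def[abs_def])
  have res: "resolvent c K (zeta w) \<phi> p = (\<Sum>j=1..M. B j \<phi> p / (w - s) ^ j) + H' w \<phi> p"
    if "w \<in> ball s r - {s}" for w \<phi> p
  proof -
    have "finite_part c K (zeta w) \<phi> p / rev_poly c K (zeta w) = G w \<phi> p / (w - s) ^ M"
      using that g(3) by (simp add: G_def)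
    then show ?thesis using eq[of w \<phi> p] that by (simp add: resolvent_def H'_def)
  qed
  \<comment> \<open>The order \<open>M\<close> of the zero only bounds the order of the pole, which
    is the largest index with a nonzero coefficient; if there were none, \<open>s\<close> would be
    removable.\<close>
  define J where "J = {j \<in> {1..M}. \<exists>\<phi>\<in>F. B j \<phi> \<noteq> (\<lambda>_. 0)}"
  have B0: "B j \<phi> = (\<lambda>_. 0)" if "j \<in> {1..M}" "j \<notin> J" "\<phi> \<in> F" for j \<phi>
    using that by (auto simp: J_def)
  have "J \<noteq> {}"
  proof
    assume "J = {}"
    then have "resolvent c K (zeta w) \<phi> = H' w \<phi>" if "w \<in> ball s r - {s}" "\<phi> \<in> F" for w \<phi>
    proof -
      have "(\<Sum>j=1..M. B j \<phi> p / (w - s) ^ j) = 0" for p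
        using B0 \<open>J = {}\<close> that(2) by (intro sum.neutral) auto
      then show ?thesis using res[OF that(1), of \<phi>] by (simp add: fun_eq_iff)
    qed
    then have "removable c K s H'" using H' g(1) by (auto simp: removable_def)
    then show False using not_removable by blast
  qed
  moreover have finJ: "finite J" by (simp add: J_def)
  ultimately have MaxJ: "Max J \<in> J" by (intro Max_in)
  show ?thesis
  proof (rule exI[of _ "Max J"], rule exI[of _ B], rule exI[of _ H'], rule exI[of _ r],
      intro conjI ballI)
    show "1 \<le> Max J" using MaxJ by (simp add: J_def)
    have le: "Max J \<le> M" using MaxJ by (simp add: J_def)
    show "\<exists>C. bop C (B j)" if "j \<in> {1..Max J}" for j using B(1)[of j] that le by simp
    show "cyl (B j \<psi>)" if "j \<in> {1..Max J}" "\<psi> \<in> F" for j \<psi>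
    proof -
      have j: "j \<in> {1..M}" using that(1) le by simp
      obtain C where C: "bop C (B j)" using B(1)[OF j] by blast
      show ?thesis using B(2)[OF j] bnd_zero[OF bop_bnd[OF C that(2)]] by (simp add: cyl_def)
    qed
    show "\<exists>\<phi>\<in>F. B (Max J) \<phi> \<noteq> (\<lambda>_. 0)" using MaxJ by (simp add: J_def)
    show "resolvent c K (zeta w) \<psi> = (\<lambda>p. (\<Sum>j=1..Max J. B j \<psi> p / (w - s) ^ j) + H' w \<psi> p)"
      if w: "w \<in> ball s r - {s}" and \<psi>: "\<psi> \<in> F" for w \<psi>
    proof
      fix p
      have "(\<Sum>j=1..Max J. B j \<psi> p / (w - s) ^ j) = (\<Sum>j=1..M. B j \<psi> p / (w - s) ^ j)"
      proof (rule sum.mono_neutral_left)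
        show "\<forall>j\<in>{1..M} - {1..Max J}. B j \<psi> p / (w - s) ^ j = 0"
        proof
          fix j assume j: "j \<in> {1..M} - {1..Max J}"
          then have "j \<notin> J" using Max_ge[OF finJ, of j] by auto
          then show "B j \<psi> p / (w - s) ^ j = 0" using B0[of j \<psi>] j \<psi> by simp
        qed
      qed (use le in auto)
      then show "resolvent c K (zeta w) \<psi> p = (\<Sum>j=1..Max J. B j \<psi> p / (w - s) ^ j) + H' w \<psi> p"
        using res[OF w] by simp
    qed
  qed (fact H' g(1))+
qed

lemma resolvent_is_resolvent:
  assumes "annihilates K c" "cmod (zeta s) * rate < 1" "rev_poly c K (zeta s) \<noteq> 0"
    and "cmod (zeta s) * (real q * W) < 1"
  shows "is_resolvent q \<theta> P \<omega> s (resolvent c K (zeta s))"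
proof -
  let ?R = "resolvent c K (zeta s)"
  let ?T = "\<lambda>\<phi> p. \<phi> p - zeta s * L \<phi> p"
  obtain CL where CL: "0 \<le> CL" "\<And>K f. bnd K f \<Longrightarrow> bnd (CL * K) (L f)" using bnd_L_exists by blast
  have "bop (CL * 1) (\<lambda>\<phi>. L \<phi>)"
    using bop_compose[OF bop_id CL(2,1) L_lin] .
  from bop_add[OF bop_id bop_scale[OF this, of "- zeta s"]]
  obtain CT where T: "bop CT ?T" by simp
  obtain CR where R: "bop CR ?R" using hol_at_bop[OF hol_at_resolvent[OF assms(2,3)]] by blast
  have right: "?T (?R \<phi>) = \<phi>" if "\<phi> \<in> F" for \<phi>
    using resolvent_right_inverse[OF assms(1) that assms(2,3)] by (simp add: fun_eq_iff)
  have left: "?R (?T \<phi>) = \<phi>" if \<phi>: "\<phi> \<in> F" for \<phi>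
  proof
    fix p
    \<comment> \<open>Since \<open>?R\<close> is a right inverse, \<open>f\<close> lies in the
      kernel of \<open>1 - zeta s * L\<close>.\<close>
    define f where "f p = 1 * ?R (?T \<phi>) p + (-1) * \<phi> p" for p
    have T\<phi>: "?T \<phi> \<in> F" using bop_mem[OF T \<phi>] .
    have "f \<in> F" unfolding f_def[abs_def] by (intro F_lincomb bop_mem[OF R] T\<phi> \<phi>)
    moreover have "f p = zeta s * L f p" for p
    proof -
      have "L f p = 1 * L (?R (?T \<phi>)) p + (-1) * L \<phi> p" unfolding f_def[abs_def] L_lin ..
      moreover have "?R (?T \<phi>) p - zeta s * L (?R (?T \<phi>)) p = \<phi> p - zeta s * L \<phi> p"
        using fun_cong[OF right[OF T\<phi>], of p] .
      ultimately show ?thesis unfolding f_def[of p] by algebra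
    qed
    ultimately have "f p = 0" using assms(4) one_minus_L_injective by blast
    then show "?R (?T \<phi>) p = \<phi> p" by (simp add: f_def)
  qed
  have "bounded_op \<theta> P ?T" "bounded_op \<theta> P ?R" using T R bounded_op_iff by blast+
  then show ?thesis
    unfolding is_resolvent_def inverse_ops_def zeta_def[symmetric] using left right by blast
qed

theorem meromorphic_continuation:
  assumes "1 < q" "sup_norm P \<omega> = W"
  shows "\<exists>R S. op_meromorphic_on \<theta> P R (half_plane q \<theta> P \<omega>) S \<and>
    (\<forall>s0\<in>S. \<exists>N A. has_principal_part \<theta> P R s0 N A \<and> (\<forall>j\<in>{1..N}. finite_rank \<theta> P (A j))) \<and>
    (\<exists>c. \<forall>s. Im s > c \<longrightarrow> s \<in> half_plane q \<theta> P \<omega> - S \<and> is_resolvent q \<theta> P \<omega> s (R s))"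
proof -
  obtain K c where ann: "annihilates K c" using ex_annihilator by blast
  then have cK: "c K \<noteq> 0" by (simp add: annihilates_def)
  let ?U = "half_plane q \<theta> P \<omega>"
  let ?d = "\<lambda>s. rev_poly c K (zeta s)"
  note U = half_plane_iff[OF assms]
  define S where "S = {s \<in> ?U. ?d s = 0 \<and> (\<forall>H. \<not> removable c K s H)}"
  \<comment> \<open>At a zero of the denominator the quotient in \<open>resolvent\<close> would be 0
    by convention; at a removable zero the correct value is that of the holomorphic replacement, and
    at a pole any value will do.\<close>
  define R where "R s = (if ?d s = 0 then (SOME H. removable c K s H) s else resolvent c K (zeta s))" for s
  have hol: "hol_at s R" if s: "s \<in> ?U - S" for s
  proof -
    obtain e where e: "0 < e" "\<And>w. w \<in> ball s e - {s} \<Longrightarrow> ?d w \<noteq> 0"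
      using rev_poly_zeros_isolated[where c = c and K = K, OF assms(1) cK, of s] by auto
    show ?thesis
    proof (cases "?d s = 0")
      case True
      define H where "H = (SOME H. removable c K s H)"
      have "\<exists>H. removable c K s H" using s True by (auto simp: S_def)
      then have "removable c K s H" unfolding H_def by (rule someI_ex)
      then obtain r where H: "hol_at s H" "0 < r"
        "\<And>w \<phi>. w \<in> ball s r - {s} \<Longrightarrow> \<phi> \<in> F \<Longrightarrow> resolvent c K (zeta w) \<phi> = H w \<phi>"
        by (auto simp: removable_def)
      show ?thesis
      proof (rule hol_at_cong[OF H(1)])
        show "0 < min e r" using e H by simp
        show "R w \<phi> = H w \<phi>" if "w \<in> ball s (min e r)" "\<phi> \<in> F" for w \<phi>
          using that e(2)[of w] H(3)[of w \<phi>] True by (cases "w = s") (auto simp: R_def H_def)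
      qed
    next
      case False
      have "hol_at s (\<lambda>w. resolvent c K (zeta w))" using s False U by (intro hol_at_resolvent) auto
      then show ?thesis using e(1)
      proof (rule hol_at_cong)
        show "R w \<phi> = resolvent c K (zeta w) \<phi>" if "w \<in> ball s e" for w \<phi>
          using that e(2)[of w] False by (cases "w = s") (auto simp: R_def)
      qed
    qed
  qed
  have pole: "\<exists>N A. has_principal_part \<theta> P R s N A \<and> (\<forall>j\<in>{1..N}. finite_rank \<theta> P (A j))"
    if s: "s \<in> S" for s
  proof -
    obtain e where e: "0 < e" "\<And>w. w \<in> ball s e - {s} \<Longrightarrow> ?d w \<noteq> 0"
      using rev_poly_zeros_isolated[where c = c and K = K, OF assms(1) cK, of s] by auto
    have s': "cmod (zeta s) * rate < 1" "?d s = 0" "\<And>H. \<not> removable c K s H"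
      using s U by (auto simp: S_def)
    from resolvent_pole[where c = c and K = K, OF assms(1) cK s']
    obtain N B H r where N: "1 \<le> N"
      and B: "\<forall>j\<in>{1..N}. (\<exists>C. bop C (B j)) \<and> (\<forall>\<psi>\<in>F. cyl (B j \<psi>))"
      and nz: "\<exists>\<phi>\<in>F. B N \<phi> \<noteq> (\<lambda>_. 0)" and H: "hol_at s H" "0 < r"
      and eq: "\<forall>w\<in>ball s r - {s}. \<forall>\<psi>\<in>F.
        resolvent c K (zeta w) \<psi> = (\<lambda>p. (\<Sum>j=1..N. B j \<psi> p / (w - s) ^ j) + H w \<psi> p)"
      by (elim exE conjE)
    obtain \<phi> where \<phi>: "\<phi> \<in> F" "B N \<phi> \<noteq> (\<lambda>_. 0)" using nz by blast
    have "has_principal_part \<theta> P R s N B"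
    proof (rule has_principal_partI[where N = N and A = B and H = H and \<phi> = \<phi>])
      show "\<exists>C. bop C (B j)" if "j \<in> {1..N}" for j using B that by blast
      show "1 \<le> N" "\<phi> \<in> F" "B N \<phi> \<noteq> (\<lambda>_. 0)" "hol_at s H" using N \<phi> H(1) by auto
      show "0 < min e r" using e(1) H(2) by simp
      show "R w \<psi> = (\<lambda>p. (\<Sum>j=1..N. B j \<psi> p / (w - s) ^ j) + H w \<psi> p)"
        if "w \<in> ball s (min e r) - {s}" "\<psi> \<in> F" for w \<psi>
        using e(2)[of w] eq that by (simp add: R_def)
    qed
    moreover have "finite_rank \<theta> P (B j)" if "j \<in> {1..N}" for j
      using B that by (intro finite_rank_cyl) blast
    ultimately show ?thesis by blast
  qed
  have sparse: "S sparse_in ?U"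
    unfolding sparse_in_ball_def
  proof
    fix s assume "s \<in> ?U"
    obtain e where e: "0 < e" "\<And>w. w \<in> ball s e - {s} \<Longrightarrow> ?d w \<noteq> 0"
      using rev_poly_zeros_isolated[where c = c and K = K, OF assms(1) cK, of s] by auto
    have "\<not> y islimpt S" if y: "y \<in> ball s e" for y
    proof
      assume lim: "y islimpt S"
      \<comment> \<open>\<open>S\<close> meets the ball in at most the point \<open>s\<close>. For
        \<open>y \<noteq> s\<close> the puncture excludes it; for \<open>y = s\<close> the limit
        point argument already supplies a point other than \<open>y\<close>.\<close>
      define T where "T = (if y = s then ball s e else ball s e - {s})"
      have "open T" "y \<in> T" using y by (auto simp: T_def open_delete)
      then obtain z where "z \<in> S" "z \<in> T" "z \<noteq> y" using lim islimptE by blast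
      then have "z \<in> ball s e - {s}" "?d z = 0" by (auto simp: T_def S_def split: if_splits)
      then show False using e(2) by blast
    qed
    then show "\<exists>e>0. \<forall>y\<in>ball s e. \<not> y islimpt S" using e(1) by blast
  qed
  have "op_meromorphic_on \<theta> P R ?U S"
    unfolding op_meromorphic_on_def
  proof (intro conjI)
    show "S \<subseteq> ?U" by (auto simp: S_def)
    show "op_holomorphic_on \<theta> P R (?U - S)" using hol by (rule op_holomorphic_onI)
    show "\<forall>s0\<in>S. \<exists>N A. has_principal_part \<theta> P R s0 N A" using pole by blast
  qed (fact sparse)
  moreover have "\<exists>c. \<forall>s. Im s > c \<longrightarrow> s \<in> ?U - S \<and> is_resolvent q \<theta> P \<omega> s (R s)"
  proof -
    obtain \<delta> where \<delta>: "0 < \<delta>" "\<And>z. cmod z < \<delta> \<Longrightarrow> rev_poly c K z \<noteq> 0"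
      using rev_poly_nonzero_near_0[of c K] cK by blast
    \<comment> \<open>The bound \<open>\<delta>\<close> avoids the zeros of the denominator, and
      \<open>1 / (real q * W)\<close> gives injectivity; the latter also implies membership in the
      half-plane, as \<theta> is below 1.\<close>
    define \<epsilon> where "\<epsilon> = min \<delta> (1 / (real q * W))"
    have qW: "0 < real q * W" using pos by simp
    have \<epsilon>: "0 < \<epsilon>" using \<delta>(1) qW by (simp add: \<epsilon>_def)
    have "s \<in> ?U - S \<and> is_resolvent q \<theta> P \<omega> s (R s)"
      if s: "1 / 2 - ln \<epsilon> / ln (real q) < Im s" for s
    proof -
      have "cmod (zeta s) < \<epsilon>" using cmod_zeta_small[OF assms(1) \<epsilon> s] .
      then have d: "?d s \<noteq> 0" and z: "cmod (zeta s) * (real q * W) < 1"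
        using \<delta>(2) qW by (auto simp: \<epsilon>_def pos_less_divide_eq)
      have "cmod (zeta s) * rate \<le> cmod (zeta s) * (real q * W)"
        using mult_left_le[of \<theta> "real q * W"] qW theta by (intro mult_left_mono) auto
      then have r: "cmod (zeta s) * rate < 1" using z by linarith
      then show ?thesis
        using resolvent_is_resolvent[OF ann r d z] U d by (auto simp: S_def R_def)
    qed
    then show ?thesis by blast
  qed
  ultimately show ?thesis using pole by blast
qed

end

section \<open>Regular graphs\<close>

lemma (in pair_graph) card_out_arcs:
  "card {e \<in> parcs G. fst e = v} = out_degree (with_proj G) v"
  by (simp add: out_degree_def out_arcs_def)

lemma (in pair_graph) swap_parcs: "e \<in> parcs G \<Longrightarrow> prod.swap e \<in> parcs G"
  using arcs_symmetric by (cases e) auto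

text \<open>The hypothesis counts outgoing edges, so predecessors of \<open>b\<close> are reversed:
  they become the edges leaving \<open>fst b\<close> other than \<open>b\<close>. The second count
  serves the left-infinite paths.\<close>

lemma (in pair_graph) card_admissible:
  assumes "\<forall>v\<in>pverts G. out_degree (with_proj G) v = q + 1" "b \<in> parcs G"
  shows "card {a \<in> parcs G. admissible a b} \<le> q" "card {a \<in> parcs G. admissible b a} \<le> q"
proof -
  have fin: "finite {e \<in> parcs G. fst e = v}" for v using pair_finite_arcs by simp
  have card: "card ({e \<in> parcs G. fst e = v} - {e}) = q" if "e \<in> parcs G" "fst e = v" for e v
  proof -
    have "v \<in> pverts G" using arc_fst_in_verts that by blast
    then have "card {e \<in> parcs G. fst e = v} = q + 1" using assms(1) card_out_arcs by simp
    then show ?thesis using fin that by simp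
  qed
  have "{a \<in> parcs G. admissible a b} \<subseteq> prod.swap ` ({e \<in> parcs G. fst e = fst b} - {b})"
  proof
    fix a assume a: "a \<in> {a \<in> parcs G. admissible a b}"
    then have "prod.swap a \<in> {e \<in> parcs G. fst e = fst b} - {b}"
      using swap_parcs by (auto simp: admissible_def)
    then show "a \<in> prod.swap ` ({e \<in> parcs G. fst e = fst b} - {b})"
      by (metis image_eqI swap_swap)
  qed
  then have "card {a \<in> parcs G. admissible a b} \<le> card ({e \<in> parcs G. fst e = fst b} - {b})"
    using fin by (meson surj_card_le finite_Diff)
  then show "card {a \<in> parcs G. admissible a b} \<le> q" using card[OF assms(2) refl] by simp
  have "{a \<in> parcs G. admissible b a} \<subseteq> {e \<in> parcs G. fst e = snd b} - {prod.swap b}"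
    by (auto simp: admissible_def)
  then have "card {a \<in> parcs G. admissible b a} \<le> card ({e \<in> parcs G. fst e = snd b} - {prod.swap b})"
    using fin by (intro card_mono) auto
  then show "card {a \<in> parcs G. admissible b a} \<le> q"
    using card[OF swap_parcs[OF assms(2)], of "snd b"] by simp
qed

text \<open>Makes the weight bounded, so that the supremum in \<open>sup_norm\<close> really
  dominates its values.\<close>

lemma finite_range_locally_constant:
  fixes f :: "(nat \<Rightarrow> 'a) \<Rightarrow> 'b" and n :: nat
  assumes "finite A" "\<And>p i. p \<in> P \<Longrightarrow> p i \<in> A"
    and loc: "\<And>p p'. p \<in> P \<Longrightarrow> p' \<in> P \<Longrightarrow> (\<And>i. i < n \<Longrightarrow> p i = p' i) \<Longrightarrow> f p = f p'"
  shows "finite (f ` P)"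
proof -
  define g where "g l = f (SOME p. p \<in> P \<and> map p [0..<n] = l)" for l
  have "f p = g (map p [0..<n])" if "p \<in> P" for p
  proof -
    define p' where "p' = (SOME p'. p' \<in> P \<and> map p' [0..<n] = map p [0..<n])"
    have "p' \<in> P \<and> map p' [0..<n] = map p [0..<n]"
      unfolding p'_def
      by (rule someI[of "\<lambda>p'. p' \<in> P \<and> map p' [0..<n] = map p [0..<n]" p]) (use that in simp)
    then have "p' \<in> P" "\<And>i. i < n \<Longrightarrow> p i = p' i" by (auto simp: map_eq_conv)
    then have "f p = f p'" by (rule loc[OF that])
    then show ?thesis by (simp add: g_def p'_def)
  qed
  moreover have "map p [0..<n] \<in> {l. set l \<subseteq> A \<and> length l = n}" if "p \<in> P" for p
    using assms(2) that by auto
  ultimately have "f ` P \<subseteq> g ` {l. set l \<subseteq> A \<and> length l = n}" by auto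
  then show ?thesis using finite_lists_length_eq[OF assms(1)] finite_subset by blast
qed

lemma weighted_shift_paths:
  assumes G: "pair_graph G" and reg: "\<forall>v\<in>pverts G. out_degree (with_proj G) v = q + 1"
    and q: "1 < q" and theta: "0 < \<theta>" "\<theta> < 1"
    and P: "P \<in> {right_paths G, left_paths G}" and \<omega>: "\<omega> \<in> locally_constant P" "\<omega> \<noteq> (\<lambda>_. 0)"
  shows "\<exists>step n. weighted_shift \<theta> P (parcs G) step q n \<omega> (sup_norm P \<omega>)"
proof -
  interpret pair_graph G by (fact G)
  obtain step where step: "P = {p. \<forall>i. p i \<in> parcs G \<and> step (p i) (p (Suc i))}"
    and card: "\<And>b. b \<in> parcs G \<Longrightarrow> card {a \<in> parcs G. step a b} \<le> q"
  proof -
    consider "P = right_paths G" | "P = left_paths G" using P by blast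
    then show ?thesis
    proof cases
      case 1
      then show ?thesis using that[of admissible] card_admissible[OF reg] by (simp add: right_paths_def)
    next
      case 2
      then show ?thesis
        using that[of "\<lambda>a b. admissible b a"] card_admissible[OF reg] by (simp add: left_paths_def)
    qed
  qed
  obtain m where m: "\<And>p p'. p \<in> P \<Longrightarrow> p' \<in> P \<Longrightarrow> (\<forall>i<m. p i = p' i) \<Longrightarrow> \<omega> p = \<omega> p'"
    and zero: "\<And>p. p \<notin> P \<Longrightarrow> \<omega> p = 0"
    using \<omega>(1) unfolding locally_constant_def by blast
  obtain p0 where p0: "p0 \<in> P" "\<omega> p0 \<noteq> 0" using \<omega>(2) zero by auto
  have "finite (\<omega> ` P)"
  proof (rule finite_range_locally_constant[where A = "parcs G" and n = m])
    show "finite (parcs G)" by (rule pair_finite_arcs)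
    show "p i \<in> parcs G" if "p \<in> P" for p i using that unfolding step by simp
    show "\<omega> p = \<omega> p'" if "p \<in> P" "p' \<in> P" "\<And>i. i < m \<Longrightarrow> p i = p' i" for p p'
      using that(3) by (intro m that(1,2)) simp
  qed
  then have "finite ((\<lambda>p. cmod (\<omega> p)) ` P)" using finite_imageI[of "\<omega> ` P" cmod] by (simp add: image_image)
  then have "bdd_above ((\<lambda>p. cmod (\<omega> p)) ` P)" by simp
  then have sup: "cmod (\<omega> p) \<le> sup_norm P \<omega>" if "p \<in> P" for p
    unfolding sup_norm_def using that by (intro cSUP_upper)
  \<comment> \<open>\<open>Suc m\<close> rather than \<open>m\<close>, because a constant weight
    allows \<open>m = 0\<close> while cylinders have to fix the first edge.\<close>
  have "weighted_shift \<theta> P (parcs G) step q (Suc m) \<omega> (sup_norm P \<omega>)"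
  proof unfold_locales
    show "0 < sup_norm P \<omega>" using sup[OF p0(1)] p0(2) by (meson zero_less_norm_iff order_less_le_trans)
    show "\<omega> p = \<omega> p'" if "p \<in> P" "p' \<in> P" "\<And>i. i < Suc m \<Longrightarrow> p i = p' i" for p p'
      using that(3) by (intro m that(1,2)) simp
    show "P \<noteq> {}" using p0(1) by blast
    show "0 < q" using q by simp
  qed (fact theta pair_finite_arcs step card zero sup zero_less_Suc)+
  then show ?thesis by blast
qed

lemma is_resolvent_zero: "is_resolvent q \<theta> P (\<lambda>_. 0) s (\<lambda>\<phi>. \<phi>)"
proof -
  have "bounded_op \<theta> P (\<lambda>\<phi>. \<phi>)"
    unfolding bounded_op_def by (auto intro: exI[of _ 1])
  then show ?thesis by (simp add: is_resolvent_def inverse_ops_def transfer_op_def)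
qed

theorem theorem3:
  fixes G :: "'v pair_pre_digraph" and q :: nat and \<theta> :: real
    and P :: "'v edge_seq set" and \<omega> :: "'v edge_seq \<Rightarrow> complex"
  assumes "pair_graph G"
    and "Digraph_Component.connected (with_proj G)"
    and "\<forall>v\<in>pverts G. out_degree (with_proj G) v = q + 1"
    and "1 < q" and "0 < \<theta>" and "\<theta> < 1"
    and "P \<in> {right_paths G, left_paths G}"
    and "\<omega> \<in> locally_constant P"
  shows "(\<omega> \<noteq> (\<lambda>_. 0) \<longrightarrow>
      (\<exists>R S. op_meromorphic_on \<theta> P R (half_plane q \<theta> P \<omega>) S \<and>
        (\<forall>s0\<in>S. \<exists>N A. has_principal_part \<theta> P R s0 N A \<and>
           (\<forall>j\<in>{1..N}. finite_rank \<theta> P (A j))) \<and>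
        (\<exists>c. \<forall>s. Im s > c \<longrightarrow>
           s \<in> half_plane q \<theta> P \<omega> - S \<and> is_resolvent q \<theta> P \<omega> s (R s)))) \<and>
    (\<omega> = (\<lambda>_. 0) \<longrightarrow>
      (\<forall>\<phi>\<in>lip_space \<theta> P. transfer_op P \<omega> \<phi> = (\<lambda>_. 0)) \<and>
      (\<forall>s. is_resolvent q \<theta> P \<omega> s (\<lambda>\<phi>. \<phi>)))"
proof (intro conjI impI)
  assume nz: "\<omega> \<noteq> (\<lambda>_. 0)"
  obtain step n where w: "weighted_shift \<theta> P (parcs G) step q n \<omega> (sup_norm P \<omega>)"
    using weighted_shift_paths[OF assms(1,3-8) nz] by (elim exE)
  show "\<exists>R S. op_meromorphic_on \<theta> P R (half_plane q \<theta> P \<omega>) S \<and>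
        (\<forall>s0\<in>S. \<exists>N A. has_principal_part \<theta> P R s0 N A \<and>
           (\<forall>j\<in>{1..N}. finite_rank \<theta> P (A j))) \<and>
        (\<exists>c. \<forall>s. Im s > c \<longrightarrow>
           s \<in> half_plane q \<theta> P \<omega> - S \<and> is_resolvent q \<theta> P \<omega> s (R s))"
    by (rule weighted_shift.meromorphic_continuation[OF w assms(4) refl])
next
  assume "\<omega> = (\<lambda>_. 0)"
  then show "\<forall>\<phi>\<in>lip_space \<theta> P. transfer_op P \<omega> \<phi> = (\<lambda>_. 0)"
    and "\<forall>s. is_resolvent q \<theta> P \<omega> s (\<lambda>\<phi>. \<phi>)"
    using is_resolvent_zero by (auto simp: transfer_op_def)
qed

end
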